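(* Let $a<b$, $\alpha\in(0,1)$, $\beta>0$, $y_a,y_b\in\mathbb{R}$, and let $L:(x,y,v,w,z)\mapsto L(x,y,v,w,z)$ and $l:(x,y,v,w)\mapsto l(x,y,v,w)$ be real-valued functions of class $C^1$. For $y\in\mathcal{F}([a,b];\mathbb{R})$ put $$z(x)=\int_a^x l\bigl(t,y(t),{^C_aD_t^\alpha}y(t),{_aI_t^\beta}y(t)\bigr)\,dt,$$ $\{y\}(x)=(x,y(x),{^C_aD_x^\alpha}y(x),{_aI_x^\beta}y(x))$, $[y](x)=(x,y(x),{^C_aD_x^\alpha}y(x),{_aI_x^\beta}y(x),z(x))$, and $$J(y)=\int_a^b L[y](x)\,dx .$$ Let $y\in\mathcal{F}([a,b];\mathbb{R})$ be a minimizer of $J$ subject to the boundary conditions $y(a)=y_a$ and $y(b)=y_b$. Then, for all $x\in[a,b]$, $y$ satisfies the fractional equation $$\frac{\partial L}{\partial y}[y](x)+{_xD^\alpha_b}\left(\frac{\partial L}{\partial v}[y](x)\right)+{_xI_b^\beta}\left(\frac{\partial L}{\partial w}[y](x)\right)+\int_x^b\frac{\partial L}{\partial z}[y](t)\,dt\cdot\frac{\partial l}{\partial y}\{y\}(x)$$ $$+{_xD^\alpha_b}\left(\int_x^b\frac{\partial L}{\partial z}[y](t)\,dt\cdot\frac{\partial l}{\partial v}\{y\}(x)\right)+{_xI^\beta_b}\left(\int_x^b\frac{\partial L}{\partial z}[y](t)\,dt\cdot\frac{\partial l}{\partial w}\{y\}(x)\right)=0.$$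
   Context: For $\gamma>0$, the left and right Riemann--Liouville fractional integrals are ${_aI_x^\gamma}f(x)=\frac{1}{\Gamma(\gamma)}\int_a^x(x-t)^{\gamma-1}f(t)\,dt$ and ${_xI_b^\gamma}f(x)=\frac{1}{\Gamma(\gamma)}\int_x^b(t-x)^{\gamma-1}f(t)\,dt$. For $\alpha\in(0,1)$, the right Riemann--Liouville fractional derivative is ${_xD_b^\alpha}f(x)=\frac{-1}{\Gamma(1-\alpha)}\frac{d}{dx}\int_x^b(t-x)^{-\alpha}f(t)\,dt$, and the left Caputo fractional derivative of an absolutely continuous $f$ is ${^C_aD_x^\alpha}f(x)=\frac{1}{\Gamma(1-\alpha)}\int_a^x(x-t)^{-\alpha}f'(t)\,dt$. $\mathcal{F}([a,b];\mathbb{R})$ denotes the class of absolutely continuous functions $y:[a,b]\to\mathbb{R}$ such that ${^C_aD_x^\alpha}y(x)$ and ${_aI_x^\beta}y(x)$ exist and are continuous on $[a,b]$. A partial derivative such as $\frac{\partial L}{\partial v}[y](x)$ is the partial derivative of $L$ with respect to its variable $v$, evaluated at the point $[y](x)$; similarly $\frac{\partial l}{\partial v}\{y\}(x)$ is evaluated at $\{y\}(x)$. An expression such as ${_xD_b^\alpha}(\phi(x))$ means the operator applied to the function $\phi$, evaluated at $x$.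
   Formalization: The two right fractional derivatives need not exist separately, so the printed equation is proved at each x where at least one exists (then both do); at every x in [a,b] the derivative of the sum is proved to exist and the equation holds with the two derivative terms combined. *)

theory Defs
  imports "HOL-Analysis.Analysis"
begin

text \<open>
  Functions on an interval \<open>[a, b]\<close> are represented by total functions on the reals whose values
  outside \<open>[a, b]\<close> are irrelevant. The singular kernels are written with \<^term>\<open>(powr)\<close>, whose value
  0 at base 0 only affects a single point of the domain of integration. Existence of an integral is
  always meant in the sense of Lebesgue, i.e. \<open>absolutely_integrable_on\<close>.
\<close>

definition rl_left_integral :: "real \<Rightarrow> real \<Rightarrow> (real \<Rightarrow> real) \<Rightarrow> real \<Rightarrow> real" where
  "rl_left_integral a \<gamma> f x =
     1 / Gamma \<gamma> * integral {a..x} (\<lambda>t. (x - t) powr (\<gamma> - 1) * f t)"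

definition rl_right_integral :: "real \<Rightarrow> real \<Rightarrow> (real \<Rightarrow> real) \<Rightarrow> real \<Rightarrow> real" where
  "rl_right_integral b \<gamma> f x =
     1 / Gamma \<gamma> * integral {x..b} (\<lambda>t. (t - x) powr (\<gamma> - 1) * f t)"

text \<open>
  The derivative is taken relative to \<open>[a, b]\<close>: it is the ordinary derivative at interior points and
  the one-sided one at the two endpoints. The left endpoint \<open>a\<close> plays no other role.
\<close>

definition rl_right_deriv :: "real \<Rightarrow> real \<Rightarrow> real \<Rightarrow> (real \<Rightarrow> real) \<Rightarrow> real \<Rightarrow> real" where
  "rl_right_deriv a b \<alpha> f x =
     - 1 / Gamma (1 - \<alpha>) *
     vector_derivative (\<lambda>s. integral {s..b} (\<lambda>t. (t - s) powr (- \<alpha>) * f t)) (at x within {a..b})"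

definition rl_right_deriv_exists :: "real \<Rightarrow> real \<Rightarrow> real \<Rightarrow> (real \<Rightarrow> real) \<Rightarrow> real \<Rightarrow> bool" where
  "rl_right_deriv_exists a b \<alpha> f x \<longleftrightarrow>
     (\<forall>s\<in>{a..b}. (\<lambda>t. (t - s) powr (- \<alpha>) * f t) absolutely_integrable_on {s..b}) \<and>
     (\<lambda>s. integral {s..b} (\<lambda>t. (t - s) powr (- \<alpha>) * f t)) differentiable (at x within {a..b})"

text \<open>
  An absolutely continuous \<open>f\<close> is differentiable almost everywhere, so the arbitrary value that
  \<^term>\<open>deriv f\<close> takes at points of non-differentiability does not influence the integral.
\<close>

definition caputo_left :: "real \<Rightarrow> real \<Rightarrow> (real \<Rightarrow> real) \<Rightarrow> real \<Rightarrow> real" where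
  "caputo_left a \<alpha> f x =
     1 / Gamma (1 - \<alpha>) * integral {a..x} (\<lambda>t. (x - t) powr (- \<alpha>) * deriv f t)"

text \<open>
  The usual epsilon-delta definition; a finite family of non-overlapping subintervals of \<open>[a, b]\<close> is
  a division of its own union.
\<close>

definition abs_continuous_on :: "real \<Rightarrow> real \<Rightarrow> (real \<Rightarrow> real) \<Rightarrow> bool" where
  "abs_continuous_on a b f \<longleftrightarrow>
     (\<forall>\<epsilon>>0. \<exists>\<delta>>0. \<forall>\<D>. \<D> division_of \<Union>\<D> \<and> \<Union>\<D> \<subseteq> {a..b} \<and>
        (\<Sum>K\<in>\<D>. Sup K - Inf K) < \<delta> \<longrightarrow> (\<Sum>K\<in>\<D>. \<bar>f (Sup K) - f (Inf K)\<bar>) < \<epsilon>)"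

definition frac_class :: "real \<Rightarrow> real \<Rightarrow> real \<Rightarrow> real \<Rightarrow> (real \<Rightarrow> real) set" where
  "frac_class a b \<alpha> \<beta> = {y. abs_continuous_on a b y \<and>
     (\<forall>x\<in>{a..b}. (\<lambda>t. (x - t) powr (- \<alpha>) * deriv y t) absolutely_integrable_on {a..x}) \<and>
     continuous_on {a..b} (caputo_left a \<alpha> y) \<and>
     (\<forall>x\<in>{a..b}. (\<lambda>t. (x - t) powr (\<beta> - 1) * y t) absolutely_integrable_on {a..x}) \<and>
     continuous_on {a..b} (rl_left_integral a \<beta> y)}"

definition C1_on :: "'a::real_normed_vector set \<Rightarrow> ('a \<Rightarrow> real) \<Rightarrow> bool" where
  "C1_on S f \<longleftrightarrow>
     (\<exists>f'. (\<forall>p\<in>S. (f has_derivative blinfun_apply (f' p)) (at p within S)) \<and> continuous_on S f')"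

type_synonym lag4 = "real \<times> real \<times> real \<times> real \<Rightarrow> real"
type_synonym lag5 = "real \<times> real \<times> real \<times> real \<times> real \<Rightarrow> real"

definition dL_y :: "lag5 \<Rightarrow> lag5" where
  "dL_y L = (\<lambda>(x, y, v, w, z). deriv (\<lambda>s. L (x, s, v, w, z)) y)"
definition dL_v :: "lag5 \<Rightarrow> lag5" where
  "dL_v L = (\<lambda>(x, y, v, w, z). deriv (\<lambda>s. L (x, y, s, w, z)) v)"
definition dL_w :: "lag5 \<Rightarrow> lag5" where
  "dL_w L = (\<lambda>(x, y, v, w, z). deriv (\<lambda>s. L (x, y, v, s, z)) w)"
definition dL_z :: "lag5 \<Rightarrow> lag5" where
  "dL_z L = (\<lambda>(x, y, v, w, z). deriv (\<lambda>s. L (x, y, v, w, s)) z)"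

definition dl_y :: "lag4 \<Rightarrow> lag4" where
  "dl_y l = (\<lambda>(x, y, v, w). deriv (\<lambda>s. l (x, s, v, w)) y)"
definition dl_v :: "lag4 \<Rightarrow> lag4" where
  "dl_v l = (\<lambda>(x, y, v, w). deriv (\<lambda>s. l (x, y, s, w)) v)"
definition dl_w :: "lag4 \<Rightarrow> lag4" where
  "dl_w l = (\<lambda>(x, y, v, w). deriv (\<lambda>s. l (x, y, v, s)) w)"

text \<open>
  \<open>curly_args\<close> is \<open>{y}(x)\<close>, \<open>aux_z\<close> is \<open>z(x)\<close>, and \<open>square_args\<close> is \<open>[y](x)\<close>.
\<close>

definition curly_args ::
  "real \<Rightarrow> real \<Rightarrow> real \<Rightarrow> (real \<Rightarrow> real) \<Rightarrow> real \<Rightarrow> real \<times> real \<times> real \<times> real" where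
  "curly_args a \<alpha> \<beta> y x = (x, y x, caputo_left a \<alpha> y x, rl_left_integral a \<beta> y x)"

definition aux_z :: "lag4 \<Rightarrow> real \<Rightarrow> real \<Rightarrow> real \<Rightarrow> (real \<Rightarrow> real) \<Rightarrow> real \<Rightarrow> real" where
  "aux_z l a \<alpha> \<beta> y x = integral {a..x} (\<lambda>t. l (curly_args a \<alpha> \<beta> y t))"

definition square_args ::
  "lag4 \<Rightarrow> real \<Rightarrow> real \<Rightarrow> real \<Rightarrow> (real \<Rightarrow> real) \<Rightarrow> real \<Rightarrow> real \<times> real \<times> real \<times> real \<times> real" where
  "square_args l a \<alpha> \<beta> y x =
     (x, y x, caputo_left a \<alpha> y x, rl_left_integral a \<beta> y x, aux_z l a \<alpha> \<beta> y x)"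

definition J_functional ::
  "lag5 \<Rightarrow> lag4 \<Rightarrow> real \<Rightarrow> real \<Rightarrow> real \<Rightarrow> real \<Rightarrow> (real \<Rightarrow> real) \<Rightarrow> real" where
  "J_functional L l a b \<alpha> \<beta> y = integral {a..b} (\<lambda>x. L (square_args l a \<alpha> \<beta> y x))"

definition is_constrained_minimizer ::
  "lag5 \<Rightarrow> lag4 \<Rightarrow> real \<Rightarrow> real \<Rightarrow> real \<Rightarrow> real \<Rightarrow> real \<Rightarrow> real \<Rightarrow> (real \<Rightarrow> real) \<Rightarrow> bool" where
  "is_constrained_minimizer L l a b \<alpha> \<beta> ya yb y \<longleftrightarrow>
     y \<in> frac_class a b \<alpha> \<beta> \<and> y a = ya \<and> y b = yb \<and>
     (\<forall>u\<in>frac_class a b \<alpha> \<beta>. u a = ya \<and> u b = yb \<longrightarrow>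
        J_functional L l a b \<alpha> \<beta> y \<le> J_functional L l a b \<alpha> \<beta> u)"

end

theory Submission
  imports Defs
begin

text \<open>
  It suffices to vary \<open>y\<close> by multiples of \<open>\<eta>(x) = \<integral>\<^sub>a\<^sup>x h\<close> with \<open>h\<close> continuous of mean zero. Since \<open>y\<close> is
  differentiable almost everywhere, the Caputo derivative of \<open>y + e \<eta>\<close> is that of \<open>y\<close> plus \<open>e\<close> times
  the fractional integral of \<open>h\<close> of order \<open>1 - \<alpha>\<close>. Fractional integration by parts turns the vanishing of the first
  variation into \<open>\<integral> (\<psi> \<eta> + K h) = 0\<close>, where \<open>K\<close> is the right fractional integral of order \<open>1 - \<alpha>\<close> of
  \<open>\<phi> = \<partial>L/\<partial>v + P \<partial>l/\<partial>v\<close> and \<open>\<psi>\<close> collects the terms of the equation in which no derivative is taken.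
  By the du Bois-Reymond lemma \<open>K' = \<psi>\<close> on all of \<open>[a, b]\<close>, so \<open>\<phi>\<close> has a right fractional derivative
  everywhere, whether or not its two summands do.
\<close>

section \<open>Almost everywhere differentiability of absolutely continuous functions\<close>

text \<open>The Caputo derivative reads \<open>deriv y\<close>, an arbitrary number where
  \<open>y\<close> is not differentiable, so even additivity of the operator is in doubt until those
  points are known to form a null set. Hence Lebesgue's theorem for absolutely continuous functions
  comes first. It is derived from Vitali coverings, by playing steep increasing intervals against
  steep decreasing ones, without passing through monotone functions. Taking \<open>h\<close>
  continuous makes every perturbed Caputo derivative continuous again, so the variation stays inside
  \<open>frac_class\<close>; mean zero is the boundary condition at \<open>b\<close>. The factor
  \<open>P\<close> has a simple origin: \<open>z\<close> depends on \<eta> through an integral from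
  \<open>a\<close> to \<open>x\<close>, and moving that integral onto \<open>dL_z L\<close>, an
  integration by parts of order one, turns it into an integral from \<open>x\<close> to
  \<open>b\<close>. Singular kernels with a moving endpoint are handled by rescaling to [0, 1]. This
  gives continuity up to the degenerate endpoint, hence an equation at every point of [a, b]
  including \<open>a\<close> and \<open>b\<close>.\<close>

lemma sum_increments_division:
  fixes F :: "real \<Rightarrow> real"
  assumes "u \<le> v" and d: "d division_of {u..v}"
  shows "(\<Sum>K\<in>d. F (Sup K) - F (Inf K)) = F v - F u"
proof -
  let ?p = "(\<lambda>K. (Inf K, K)) ` d"
  have ne: "K \<noteq> {} \<and> (\<exists>s t. K = {s..t}) \<and> K \<subseteq> {u..v}" if "K \<in> d" for K
    using division_ofD(2-4)[OF d that] by auto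
  have "?p tagged_division_of {u..v}"
  proof (rule tagged_division_ofI)
    show "finite ?p" using d by blast
    fix x K assume "(x, K) \<in> ?p"
    then have K: "K \<in> d" "x = Inf K" by auto
    with ne obtain s t where "K = {s..t}" "s \<le> t" by fastforce
    then show "x \<in> K" "\<exists>a b. K = cbox a b" using K by auto
    show "K \<subseteq> {u..v}" using ne K by blast
    fix x' K' assume "(x', K') \<in> ?p" "(x, K) \<noteq> (x', K')"
    then show "interior K \<inter> interior K' = {}" using K d by auto
  next
    show "\<Union> {K. \<exists>x. (x, K) \<in> ?p} = {u..v}" using d by (auto simp: image_iff)
  qed
  from additive_tagged_division_1[OF assms(1) this, of F]
  show ?thesis by (subst (asm) sum.reindex) (auto simp: inj_on_def o_def)
qed

text \<open>The members of \<open>B\<close> inside a given \<open>I\<close> of \<open>A\<close>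
  extend to a division of \<open>I\<close>; discarding them leaves \<open>R\<close>, and increments
  telescope on each \<open>I\<close>. The function \<open>F\<close> is arbitrary because one and the
  same \<open>R\<close> is needed twice: with the identity, to see that it is short, and with
  \<open>f\<close>, to see that its increment is large.\<close>

lemma division_of_difference:
  assumes fA: "finite A" and A: "\<And>I. I \<in> A \<Longrightarrow> \<exists>u v. u < v \<and> I = {u..v}" and dA: "pairwise disjnt A"
    and fB: "finite B" and B: "\<And>K. K \<in> B \<Longrightarrow> \<exists>u v. u < v \<and> K = {u..v}" and dB: "pairwise disjnt B"
    and sub: "\<And>K. K \<in> B \<Longrightarrow> \<exists>I\<in>A. K \<subseteq> I"
  obtains R :: "real set set" where "R division_of \<Union>R" "\<Union>R \<subseteq> \<Union>A"
    "\<And>F::real \<Rightarrow> real. (\<Sum>K\<in>R. F (Sup K) - F (Inf K)) =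
       (\<Sum>K\<in>A. F (Sup K) - F (Inf K)) - (\<Sum>K\<in>B. F (Sup K) - F (Inf K))"
proof -
  define BI where "BI I = {K\<in>B. K \<subseteq> I}" for I
  have "\<exists>Q. BI I \<subseteq> Q \<and> Q division_of I" if "I \<in> A" for I
  proof -
    from A[OF that] obtain u v where I: "u < v" "I = {u..v}" by blast
    have "BI I division_of \<Union>(BI I)"
    proof (rule division_ofI)
      show "finite (BI I)" using fB by (auto simp: BI_def)
      fix K assume K: "K \<in> BI I"
      then have "K \<in> B" by (simp add: BI_def)
      then obtain s t where "s < t" "K = {s..t}" using B by blast
      then show "K \<noteq> {}" "\<exists>a b. K = cbox a b" by auto
      show "K \<subseteq> \<Union> (BI I)" using K by auto
      fix K' assume "K' \<in> BI I" "K \<noteq> K'"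
      then have "K \<inter> K' = {}" using K dB by (auto simp: BI_def pairwise_def disjnt_def)
      then show "interior K \<inter> interior K' = {}" using interior_subset by blast
    qed auto
    moreover have "\<Union>(BI I) \<subseteq> cbox u v" using I by (auto simp: BI_def)
    ultimately show ?thesis using partial_division_extend_interval I by (metis box_real(2))
  qed
  then obtain Q where Q: "\<And>I. I \<in> A \<Longrightarrow> BI I \<subseteq> Q I" "\<And>I. I \<in> A \<Longrightarrow> Q I division_of I" by metis
  define R where "R = (\<Union>I\<in>A. Q I - BI I)"
  have Qsub: "K \<subseteq> I" "K \<noteq> {}" if "I \<in> A" "K \<in> Q I" for I K
    using Q(2)[OF that(1)] that(2) by auto
  have RD: "R division_of \<Union>R"
  proof (rule division_ofI)
    show "finite R" using fA Q(2) by (auto simp: R_def)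
    fix K assume K: "K \<in> R"
    then obtain I where I: "I \<in> A" "K \<in> Q I" by (auto simp: R_def)
    then show "K \<noteq> {}" "\<exists>a b. K = cbox a b" using division_ofD(3,4)[OF Q(2)[OF I(1)] I(2)] by auto
    show "K \<subseteq> \<Union> R" using K by auto
    fix K' assume K': "K' \<in> R" "K \<noteq> K'"
    then obtain I' where I': "I' \<in> A" "K' \<in> Q I'" by (auto simp: R_def)
    show "interior K \<inter> interior K' = {}"
    proof (cases "I = I'")
      case True then show ?thesis using Q(2)[OF I(1)] I I' K' by auto
    next
      case False
      then have "I \<inter> I' = {}" using dA I I' by (auto simp: pairwise_def disjnt_def)
      then have "K \<inter> K' = {}" using Qsub I I' by blast
      then show ?thesis using interior_subset by blast
    qed
  qed auto
  have B_eq: "B = (\<Union>I\<in>A. BI I)" using sub by (auto simp: BI_def)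
  have disj: "Q I \<inter> Q J = {}" if "I \<in> A" "J \<in> A" "I \<noteq> J" for I J
  proof -
    have "I \<inter> J = {}" using dA that by (auto simp: pairwise_def disjnt_def)
    then show ?thesis using Qsub[OF that(1)] Qsub[OF that(2)] by blast
  qed
  show ?thesis
  proof
    show "R division_of \<Union>R" by fact
    show "\<Union>R \<subseteq> \<Union>A" unfolding R_def using Qsub(1) by blast
    fix F :: "real \<Rightarrow> real"
    let ?g = "\<lambda>K. F (Sup K) - F (Inf K)"
    have fin: "finite (Q I)" if "I \<in> A" for I using Q(2)[OF that] by blast
    have "sum ?g R = (\<Sum>I\<in>A. sum ?g (Q I - BI I))"
      unfolding R_def using fA fin disj by (intro sum.UNION_disjoint) blast+
    also have "\<dots> = (\<Sum>I\<in>A. ?g I - sum ?g (BI I))"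
    proof (rule sum.cong)
      fix I assume I: "I \<in> A"
      with A obtain u v where uv: "u < v" "I = {u..v}" by blast
      have "sum ?g (Q I) = ?g I" using sum_increments_division[of u v "Q I" F] Q(2)[OF I] uv by auto
      then show "sum ?g (Q I - BI I) = ?g I - sum ?g (BI I)"
        using sum_diff[OF fin[OF I] Q(1)[OF I], of ?g] by simp
    qed simp
    also have "\<dots> = sum ?g A - (\<Sum>I\<in>A. sum ?g (BI I))" by (simp add: sum_subtractf)
    also have "(\<Sum>I\<in>A. sum ?g (BI I)) = sum ?g B"
      unfolding B_eq
    proof (rule sum.UNION_disjoint[symmetric])
      show "\<forall>I\<in>A. finite (BI I)" using fB by (simp add: BI_def)
      show "\<forall>I\<in>A. \<forall>J\<in>A. I \<noteq> J \<longrightarrow> BI I \<inter> BI J = {}" using disj Q(1) by blast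
    qed (fact fA)
    finally show "sum ?g R = sum ?g A - sum ?g B" .
  qed
qed

text \<open>Vitali's theorem yields a countable disjoint family covering almost all of
  \<open>E\<close>; since \<open>E\<close> has finite measure, finitely many members already miss
  less than \<open>e\<close>. The predicate \<open>Q\<close> is a parameter so that slope conditions
  and containment in earlier intervals can both be imposed.\<close>

lemma Vitali_finite_intervals:
  fixes E U :: "real set"
  assumes E: "E \<in> lmeasurable" and U: "open U" "E \<subseteq> U" and e: "e > 0"
    and fine: "\<And>x d. x \<in> E \<Longrightarrow> d > 0 \<Longrightarrow> \<exists>u v. u < v \<and> x \<in> {u..v} \<and> v - u < d \<and> Q u v"
  obtains D where "finite D" "\<And>K. K \<in> D \<Longrightarrow> \<exists>u v. u < v \<and> K = {u..v} \<and> K \<subseteq> U \<and> Q u v"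
    "pairwise disjnt D" "measure lebesgue (E - \<Union>D) < e"
proof -
  \<comment> \<open>The covering theorem speaks of balls, so an interval is encoded by its centre
    and radius.\<close>
  define I where "I = {(c, r). r > 0 \<and> {c - r..c + r} \<subseteq> U \<and> Q (c - r) (c + r)}"
  have 1: "0 < snd i" if "i \<in> I" for i using that by (auto simp: I_def)
  have 2: "\<exists>i. i \<in> I \<and> x \<in> cball (fst i) (snd i) \<and> snd i < d" if x: "x \<in> E" and d: "0 < d" for x d
  proof -
    obtain r where r: "r > 0" "cball x r \<subseteq> U" using U x open_contains_cball by blast
    obtain u v where uv: "u < v" "x \<in> {u..v}" "v - u < min d r" "Q u v"
      using fine[OF x, of "min d r"] d r by auto
    define c where "c = (u + v) / 2"
    define q where "q = (v - u) / 2"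
    have cq: "c - q = u" "c + q = v" by (auto simp: c_def q_def field_simps)
    have "{u..v} \<subseteq> cball x r" using uv by (auto simp: dist_real_def)
    then have "(c, q) \<in> I" unfolding I_def using uv r cq by (auto simp: q_def)
    moreover have "x \<in> cball c q" using uv cq by (auto simp: dist_real_def)
    moreover have "q < d" using uv by (auto simp: q_def)
    ultimately show ?thesis by (intro exI[of _ "(c, q)"]) auto
  qed
  obtain C where C: "countable C" "C \<subseteq> I"
     "pairwise (\<lambda>i j. disjnt (cball (fst i) (snd i)) (cball (fst j) (snd j))) C"
     "negligible (E - (\<Union>i \<in> C. cball (fst i) (snd i)))"
    using Vitali_covering_theorem_cballs[of I snd E fst] 1 2 by blast
  define Cn where "Cn n = {i\<in>C. to_nat_on C i < n}" for n
  have finC: "finite (Cn n)" for n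
  proof (rule finite_imageD)
    show "finite (to_nat_on C ` Cn n)" by (rule finite_subset[of _ "{..<n}"]) (auto simp: Cn_def)
    show "inj_on (to_nat_on C) (Cn n)" using inj_on_to_nat_on[OF C(1)] by (rule inj_on_subset) (auto simp: Cn_def)
  qed
  \<comment> \<open>What the first \<open>n\<close> balls miss: a decreasing sequence with null
    intersection, so continuity from above makes its measure fall below \<open>e\<close>.\<close>
  define En where "En n = E - (\<Union>i \<in> Cn n. cball (fst i) (snd i))" for n
  have Enm: "En n \<in> lmeasurable" for n unfolding En_def using E finC
    by (intro fmeasurable_Diff) (auto intro!: sets.finite_UN)
  have "(\<lambda>n. measure lebesgue (En n)) \<longlonglongrightarrow> measure lebesgue (\<Inter>n. En n)"
  proof (rule Lim_measure_decseq)
    show "range En \<subseteq> sets lebesgue" using Enm by auto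
    show "decseq En" by (rule decseq_SucI) (force simp: En_def Cn_def)
    show "emeasure lebesgue (En n) \<noteq> \<infinity>" for n using fmeasurableD2[OF Enm[of n]] by simp
  qed
  moreover have "(\<Inter>n. En n) = E - (\<Union>i \<in> C. cball (fst i) (snd i))"
    by (auto simp: En_def Cn_def)
  then have "measure lebesgue (\<Inter>n. En n) = 0" using C(4) by (simp add: negligible_imp_measure0)
  ultimately have "eventually (\<lambda>n. measure lebesgue (En n) < e) sequentially"
    using e order_tendstoD(2) by fastforce
  then obtain n where n: "measure lebesgue (En n) < e" by (auto simp: eventually_sequentially)
  show ?thesis
  proof
    let ?D = "(\<lambda>i. cball (fst i) (snd i)) ` Cn n"
    show "finite ?D" using finC by auto
    show "\<exists>u v. u < v \<and> K = {u..v} \<and> K \<subseteq> U \<and> Q u v" if "K \<in> ?D" for K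
    proof -
      from that obtain c r where "(c, r) \<in> C" "K = cball c r" by (auto simp: Cn_def)
      then have "c - r < c + r" "K = {c - r..c + r}" "K \<subseteq> U" "Q (c - r) (c + r)" using C(2) by (auto simp: I_def cball_eq_atLeastAtMost)
      then show ?thesis by blast
    qed
    show "pairwise disjnt ?D" unfolding pairwise_image
      by (rule pairwise_mono[OF C(3)]) (auto simp: Cn_def)
    show "measure lebesgue (E - \<Union>?D) < e" using n by (simp add: En_def)
  qed
qed

section \<open>Elementary properties of absolute continuity\<close>

lemma abs_continuous_onD:
  assumes "abs_continuous_on a b f" "\<epsilon> > 0"
  obtains \<delta> where "\<delta> > 0" "\<And>D. D division_of \<Union>D \<Longrightarrow> \<Union>D \<subseteq> {a..b} \<Longrightarrow>
    (\<Sum>K\<in>D. Sup K - Inf K) < \<delta> \<Longrightarrow> (\<Sum>K\<in>D. \<bar>f (Sup K) - f (Inf K)\<bar>) < \<epsilon>"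
  using assms unfolding abs_continuous_on_def by meson

lemma abs_continuous_on_imp_continuous_on:
  assumes "abs_continuous_on a b f"
  shows "continuous_on {a..b} f"
proof -
  have "\<exists>d>0. \<forall>x'\<in>{a..b}. dist x' x < d \<longrightarrow> dist (f x') (f x) < e" if x: "x \<in> {a..b}" and e: "e > 0" for x e
  proof -
    obtain d where d: "d > 0" and dd: "\<And>D. D division_of \<Union>D \<Longrightarrow> \<Union>D \<subseteq> {a..b} \<Longrightarrow>
      (\<Sum>K\<in>D. Sup K - Inf K) < d \<Longrightarrow> (\<Sum>K\<in>D. \<bar>f (Sup K) - f (Inf K)\<bar>) < e"
      using abs_continuous_onD[OF assms e] by blast
    have *: "\<bar>f v - f u\<bar> < e" if "u \<le> v" "u \<in> {a..b}" "v \<in> {a..b}" "v - u < d" for u v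
    proof -
      have "{{u..v}} division_of \<Union>{{u..v}}" using that by (auto intro!: division_ofI)
      from dd[OF this] show ?thesis using that by simp
    qed
    have "dist (f x') (f x) < e" if "x' \<in> {a..b}" "dist x' x < d" for x'
      using *[of x x'] *[of x' x] that x by (cases "x \<le> x'") (auto simp: dist_real_def abs_minus_commute)
    with d show ?thesis by blast
  qed
  then show ?thesis by (simp add: continuous_on_iff)
qed

lemma abs_continuous_on_cong:
  assumes "\<And>x. x \<in> {a..b} \<Longrightarrow> f x = g x" and f: "abs_continuous_on a b f"
  shows "abs_continuous_on a b g"
  unfolding abs_continuous_on_def
proof (intro allI impI)
  fix e :: real assume "e > 0"
  then obtain d where d: "d > 0" and dd: "\<And>D. D division_of \<Union>D \<Longrightarrow> \<Union>D \<subseteq> {a..b} \<Longrightarrow>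
      (\<Sum>K\<in>D. Sup K - Inf K) < d \<Longrightarrow> (\<Sum>K\<in>D. \<bar>f (Sup K) - f (Inf K)\<bar>) < e"
      using abs_continuous_onD[OF f] by blast
  have "(\<Sum>K\<in>D. \<bar>g (Sup K) - g (Inf K)\<bar>) < e"
    if D: "D division_of \<Union>D" "\<Union>D \<subseteq> {a..b}" "(\<Sum>K\<in>D. Sup K - Inf K) < d" for D
  proof -
    have "g (Sup K) = f (Sup K) \<and> g (Inf K) = f (Inf K)" if K: "K \<in> D" for K
    proof -
      obtain u v where "K = {u..v}" "u \<le> v" using division_ofD(3,4)[OF D(1) K] by auto
      moreover have "K \<subseteq> {a..b}" using D(2) K by auto
      ultimately show ?thesis using assms(1) by auto
    qed
    then show ?thesis using dd[OF D] by simp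
  qed
  with d show "\<exists>\<delta>>0. \<forall>\<D>. \<D> division_of \<Union> \<D> \<and> \<Union> \<D> \<subseteq> {a..b} \<and>
      (\<Sum>K\<in>\<D>. Sup K - Inf K) < \<delta> \<longrightarrow> (\<Sum>K\<in>\<D>. \<bar>g (Sup K) - g (Inf K)\<bar>) < e" by blast
qed

lemma abs_continuous_on_add:
  assumes f: "abs_continuous_on a b f" and g: "abs_continuous_on a b g"
  shows "abs_continuous_on a b (\<lambda>x. f x + g x)"
  unfolding abs_continuous_on_def
proof (intro allI impI)
  fix e :: real assume "e > 0"
  then have e: "e / 2 > 0" by simp
  obtain d1 where d1: "d1 > 0" "\<And>D. D division_of \<Union>D \<Longrightarrow> \<Union>D \<subseteq> {a..b} \<Longrightarrow>
      (\<Sum>K\<in>D. Sup K - Inf K) < d1 \<Longrightarrow> (\<Sum>K\<in>D. \<bar>f (Sup K) - f (Inf K)\<bar>) < e/2"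
    using abs_continuous_onD[OF f e] by blast
  obtain d2 where d2: "d2 > 0" "\<And>D. D division_of \<Union>D \<Longrightarrow> \<Union>D \<subseteq> {a..b} \<Longrightarrow>
      (\<Sum>K\<in>D. Sup K - Inf K) < d2 \<Longrightarrow> (\<Sum>K\<in>D. \<bar>g (Sup K) - g (Inf K)\<bar>) < e/2"
    using abs_continuous_onD[OF g e] by blast
  have "(\<Sum>K\<in>D. \<bar>f (Sup K) + g (Sup K) - (f (Inf K) + g (Inf K))\<bar>) < e"
    if D: "D division_of \<Union>D" "\<Union>D \<subseteq> {a..b}" "(\<Sum>K\<in>D. Sup K - Inf K) < min d1 d2" for D
  proof -
    have "(\<Sum>K\<in>D. \<bar>f (Sup K) + g (Sup K) - (f (Inf K) + g (Inf K))\<bar>) \<le>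
      (\<Sum>K\<in>D. \<bar>f (Sup K) - f (Inf K)\<bar>) + (\<Sum>K\<in>D. \<bar>g (Sup K) - g (Inf K)\<bar>)"
      unfolding sum.distrib[symmetric] by (rule sum_mono) arith
    then show ?thesis using d1(2)[OF D(1,2)] d2(2)[OF D(1,2)] D(3) by simp
  qed
  with d1(1) d2(1) show "\<exists>\<delta>>0. \<forall>\<D>. \<D> division_of \<Union> \<D> \<and> \<Union> \<D> \<subseteq> {a..b} \<and>
      (\<Sum>K\<in>\<D>. Sup K - Inf K) < \<delta> \<longrightarrow>
      (\<Sum>K\<in>\<D>. \<bar>f (Sup K) + g (Sup K) - (f (Inf K) + g (Inf K))\<bar>) < e"
    by (intro exI[of _ "min d1 d2"]) auto
qed

lemma lipschitz_on_imp_abs_continuous_on: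
  assumes "C-lipschitz_on {a..b} f"
  shows "abs_continuous_on a b f"
  unfolding abs_continuous_on_def
proof (intro allI impI)
  fix e :: real assume e: "e > 0"
  have C: "C \<ge> 0" using assms lipschitz_on_nonneg by blast
  \<comment> \<open>The constant \<open>C + 1\<close> is positive even if \<open>C\<close> is 0, so
    the quotient makes sense and the last inequality is strict.\<close>
  have "(\<Sum>K\<in>D. \<bar>f (Sup K) - f (Inf K)\<bar>) < e"
    if D: "D division_of \<Union>D" "\<Union>D \<subseteq> {a..b}" "(\<Sum>K\<in>D. Sup K - Inf K) < e / (C + 1)" for D
  proof -
    have "\<bar>f (Sup K) - f (Inf K)\<bar> \<le> (C + 1) * (Sup K - Inf K)" if K: "K \<in> D" for K
    proof -
      obtain u v where uv: "K = {u..v}" "u \<le> v" using division_ofD(3,4)[OF D(1) K] by auto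
      moreover have "K \<subseteq> {a..b}" using D(2) K by auto
      ultimately have "\<bar>f v - f u\<bar> \<le> C * (v - u)"
        using lipschitz_onD[OF assms, of v u] by (auto simp: dist_real_def)
      then show ?thesis using uv by (auto simp: algebra_simps)
    qed
    then have "(\<Sum>K\<in>D. \<bar>f (Sup K) - f (Inf K)\<bar>) \<le> (\<Sum>K\<in>D. (C + 1) * (Sup K - Inf K))" by (rule sum_mono)
    also have "\<dots> < (C + 1) * (e / (C + 1))" unfolding sum_distrib_left[symmetric]
      using C D(3) by (intro mult_strict_left_mono) auto
    finally show ?thesis using C by simp
  qed
  with C e show "\<exists>\<delta>>0. \<forall>\<D>. \<D> division_of \<Union> \<D> \<and> \<Union> \<D> \<subseteq> {a..b} \<and>
      (\<Sum>K\<in>\<D>. Sup K - Inf K) < \<delta> \<longrightarrow> (\<Sum>K\<in>\<D>. \<bar>f (Sup K) - f (Inf K)\<bar>) < e"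
    by (intro exI[of _ "e / (C + 1)"]) auto
qed

lemma abs_continuous_on_uminus:
  "abs_continuous_on a b f \<Longrightarrow> abs_continuous_on a b (\<lambda>x. - f x)"
  unfolding abs_continuous_on_def by (simp add: abs_minus_commute)

section \<open>Null sets on which an absolutely continuous function is too steep\<close>

lemma measure_disjoint_intervals:
  assumes "finite D" "pairwise disjnt D" "\<And>K. K \<in> D \<Longrightarrow> \<exists>u v. u < v \<and> K = {u..v::real}"
  shows "\<Union>D \<in> lmeasurable" "measure lebesgue (\<Union>D) = (\<Sum>K\<in>D. Sup K - Inf K)"
proof -
  have K: "K \<in> lmeasurable \<and> measure lebesgue K = Sup K - Inf K" if K: "K \<in> D" for K
  proof -
    obtain u v where "u < v" "K = {u..v}" using assms(3)[OF K] by blast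
    then show ?thesis by simp
  qed
  then show "\<Union>D \<in> lmeasurable" using assms(1) by (intro fmeasurable.finite_Union) auto
  have "measure lebesgue (\<Union>D) = (\<Sum>K\<in>D. measure lebesgue K)"
    using assms(1,2) K by (intro measure_negligible_finite_Union) (auto simp: pairwise_def disjnt_def)
  then show "measure lebesgue (\<Union>D) = (\<Sum>K\<in>D. Sup K - Inf K)" using K by simp
qed

lemma measure_cover_lower:
  fixes E T :: "'a::euclidean_space set"
  assumes "E \<in> lmeasurable" "T \<in> lmeasurable" "measure lebesgue (E - T) < e"
  shows "measure lebesgue E - e < measure lebesgue T"
proof -
  have "measure lebesgue E \<le> measure lebesgue (T \<union> (E - T))"
    using assms by (intro measure_mono_fmeasurable) auto
  also have "\<dots> \<le> measure lebesgue T + measure lebesgue (E - T)"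
    using assms by (intro measure_Un_le) auto
  finally show ?thesis using assms(3) by simp
qed

text \<open>
  If \<open>A\<close> is a family of steeply increasing intervals that nearly exhausts \<open>E\<close>, and \<open>B\<close> a family of
  steeply decreasing ones inside \<open>A\<close> that also nearly exhausts \<open>E\<close>, then \<open>f\<close> has a large increment
  over the small set that is left of \<open>A\<close> after removing \<open>B\<close>.
\<close>

lemma abs_continuous_on_steep_negligible:
  fixes f :: "real \<Rightarrow> real"
  assumes f: "abs_continuous_on a b f" and E: "E \<in> lmeasurable" "E \<subseteq> {a<..<b}" and r: "r > 0"
    and up: "\<And>x d. x \<in> E \<Longrightarrow> d > 0 \<Longrightarrow> \<exists>u v. u < v \<and> x \<in> {u..v} \<and> v - u < d \<and> f v - f u > r * (v - u)"
    and dn: "\<And>x d. x \<in> E \<Longrightarrow> d > 0 \<Longrightarrow> \<exists>u v. u < v \<and> x \<in> {u..v} \<and> v - u < d \<and> f v - f u < - r * (v - u)"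
  shows "negligible E"
proof (rule ccontr)
  assume "\<not> negligible E"
  define s where "s = measure lebesgue E"
  have s: "s > 0" using \<open>\<not> negligible E\<close> E(1) unfolding s_def
    by (metis measure_nonneg negligible_iff_measure order_le_less)
  obtain d where d: "d > 0" and dd: "\<And>D. D division_of \<Union>D \<Longrightarrow> \<Union>D \<subseteq> {a..b} \<Longrightarrow>
      (\<Sum>K\<in>D. Sup K - Inf K) < d \<Longrightarrow> (\<Sum>K\<in>D. \<bar>f (Sup K) - f (Inf K)\<bar>) < r * s"
    using abs_continuous_onD[OF f mult_pos_pos[OF r s]] by blast
  \<comment> \<open>The family \<open>A\<close> will have length between \<open>s - e\<close> and
    \<open>s + e\<close>, and \<open>B\<close> length above \<open>s - 2 * e\<close>. The remainder
    is therefore shorter than \<open>3 * e\<close>, hence than \<open>d\<close>, while its increment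
    is at least \<open>r\<close> times the sum of both lengths, which exceeds
    \<open>2 * s - 3 * e\<close> and so \<open>s\<close>.\<close>
  define e where "e = min (s / 4) (d / 4)"
  have e: "e > 0" "3 * e < d" "4 * e \<le> s" using d s by (auto simp: e_def)
  obtain T where T: "open T" "E \<subseteq> T" "T - E \<in> lmeasurable" "emeasure lebesgue (T - E) < ennreal e"
    using sets_lebesgue_outer_open[of E e] E(1) e(1) by blast
  \<comment> \<open>Intervals chosen inside \<open>U\<close> cannot have total length much above the
    measure of \<open>E\<close>; this is the upper bound on the length of \<open>A\<close>.\<close>
  define U where "U = T \<inter> {a<..<b}"
  have U: "open U" "E \<subseteq> U" "U \<subseteq> {a..b}" using T E by (auto simp: U_def)
  have Um: "U \<in> lmeasurable" using U(1,3) by (metis bounded_closed_interval bounded_subset lmeasurable_open)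
  have "measure lebesgue (T - E) < e" using T(3,4) e
    by (metis emeasure_eq_measure2 ennreal_less_iff measure_nonneg)
  moreover have "U \<subseteq> E \<union> (T - E)" by (auto simp: U_def)
  then have "measure lebesgue U \<le> measure lebesgue (E \<union> (T - E))"
    using E(1) T(3) Um by (intro measure_mono_fmeasurable fmeasurable.Un) blast+
  moreover have "measure lebesgue (E \<union> (T - E)) \<le> s + measure lebesgue (T - E)"
    unfolding s_def using E T by (intro measure_Un_le) auto
  ultimately have mU: "measure lebesgue U < s + e" by simp
  obtain A where A: "finite A" "\<And>K. K \<in> A \<Longrightarrow> \<exists>u v. u < v \<and> K = {u..v} \<and> K \<subseteq> U \<and> f v - f u > r * (v - u)"
      "pairwise disjnt A" "measure lebesgue (E - \<Union>A) < e"
    using Vitali_finite_intervals[OF E(1) U(1,2) e(1), of "\<lambda>u v. f v - f u > r * (v - u)"] up by blast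
  have A': "\<And>K. K \<in> A \<Longrightarrow> \<exists>u v. u < v \<and> K = {u..v}" using A(2) by blast
  \<comment> \<open>Around an interior point of a member of \<open>A\<close>, all sufficiently short
    intervals stay in that member, so the second Vitali family can be nested in the first. Only
    endpoints of finitely many intervals are lost.\<close>
  define E' where "E' = E \<inter> (\<Union>K\<in>A. interior K)"
  have E'm: "E' \<in> lmeasurable" unfolding E'_def using E(1)
    by (intro fmeasurable_Int_fmeasurable) (auto intro!: lborelD borel_open)
  note mA = measure_disjoint_intervals[OF A(1,3) A']
  have "negligible (\<Union>K\<in>A. frontier K)"
  proof (rule negligible_Union)
    show "finite (frontier ` A)" using A by auto
    fix K assume "K \<in> frontier ` A"
    then obtain u v where "K = frontier {u..v::real}" using A' by blast
    then show "negligible K" using negligible_convex_frontier[of "{u..v}"] by simp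
  qed
  then have "measure lebesgue (E - (\<Union>K\<in>A. interior K)) = measure lebesgue (E - \<Union>A)"
  proof (intro measure_negligible_symdiff)
    show "E - \<Union>A \<in> lmeasurable" using E mA by auto
    show "negligible (sym_diff (E - \<Union>A) (E - (\<Union>K\<in>A. interior K)))"
      apply (rule negligible_subset[OF \<open>negligible (\<Union>K\<in>A. frontier K)\<close>])
      using interior_subset A' by (fastforce simp: frontier_def)
  qed
  then have "measure lebesgue (E - E') < e" using A(4) by (simp add: E'_def Diff_Int)
  then have mE': "measure lebesgue E' > s - e" using measure_cover_lower[OF E(1) E'm] by (simp add: s_def)
  obtain B where B: "finite B" "\<And>K. K \<in> B \<Longrightarrow> \<exists>u v. u < v \<and> K = {u..v} \<and> K \<subseteq> U \<and>
        f v - f u < - r * (v - u) \<and> (\<exists>I\<in>A. {u..v} \<subseteq> I)"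
      "pairwise disjnt B" "measure lebesgue (E' - \<Union>B) < e"
  proof (rule Vitali_finite_intervals[OF E'm U(1) _ e(1),
      of "\<lambda>u v. f v - f u < - r * (v - u) \<and> (\<exists>I\<in>A. {u..v} \<subseteq> I)"])
    show "E' \<subseteq> U" using U by (auto simp: E'_def)
    fix x d' :: real assume x: "x \<in> E'" and d': "d' > 0"
    then obtain I where I: "I \<in> A" "x \<in> interior I" "x \<in> E" by (auto simp: E'_def)
    then obtain q where q: "q > 0" "cball x q \<subseteq> I"
      by (meson interior_subset open_contains_cball open_interior order_trans)
    obtain u v where uv: "u < v" "x \<in> {u..v}" "v - u < min d' q" "f v - f u < - r * (v - u)"
      using dn[OF I(3), of "min d' q"] d' q by auto
    then have "{u..v} \<subseteq> cball x q" by (auto simp: dist_real_def)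
    then show "\<exists>u v. u < v \<and> x \<in> {u..v} \<and> v - u < d' \<and> f v - f u < - r * (v - u) \<and> (\<exists>I\<in>A. {u..v} \<subseteq> I)"
      using uv q I by (intro exI[of _ u] exI[of _ v]) auto
  qed blast
  have B': "\<And>K. K \<in> B \<Longrightarrow> \<exists>u v. u < v \<and> K = {u..v}" using B(2) by blast
  note mB = measure_disjoint_intervals[OF B(1,3) B']
  obtain R where R: "R division_of \<Union>R" "\<Union>R \<subseteq> \<Union>A"
    "\<And>F::real \<Rightarrow> real. (\<Sum>K\<in>R. F (Sup K) - F (Inf K)) =
       (\<Sum>K\<in>A. F (Sup K) - F (Inf K)) - (\<Sum>K\<in>B. F (Sup K) - F (Inf K))"
    using division_of_difference[OF A(1) A' A(3) B(1) B' B(3)] B(2) by blast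
  have lA: "(\<Sum>K\<in>A. Sup K - Inf K) > s - e" "(\<Sum>K\<in>A. Sup K - Inf K) < s + e"
  proof -
    show "(\<Sum>K\<in>A. Sup K - Inf K) > s - e"
      using measure_cover_lower[OF E(1) mA(1) A(4)] mA(2) by (simp add: s_def)
    have "measure lebesgue (\<Union>A) \<le> measure lebesgue U" using mA(1) A(2) Um
      by (intro measure_mono_fmeasurable) (blast, auto)
    then show "(\<Sum>K\<in>A. Sup K - Inf K) < s + e" using mU mA(2) by simp
  qed
  have lB: "(\<Sum>K\<in>B. Sup K - Inf K) > s - 2 * e"
    using measure_cover_lower[OF E'm mB(1) B(4)] mB(2) mE' by simp
  have "(\<Sum>K\<in>R. Sup K - Inf K) < d" using R(3)[of "\<lambda>x. x"] lA lB e by simp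
  moreover have "\<Union>R \<subseteq> {a..b}" using R(2) A(2) U(3) by blast
  ultimately have "(\<Sum>K\<in>R. \<bar>f (Sup K) - f (Inf K)\<bar>) < r * s" using dd R(1) by blast
  moreover have "(\<Sum>K\<in>R. f (Sup K) - f (Inf K)) \<le> (\<Sum>K\<in>R. \<bar>f (Sup K) - f (Inf K)\<bar>)"
    by (rule sum_mono) simp
  moreover have "(\<Sum>K\<in>A. f (Sup K) - f (Inf K)) \<ge> r * (\<Sum>K\<in>A. Sup K - Inf K)"
    unfolding sum_distrib_left using A(2) by (intro sum_mono) fastforce
  moreover have "(\<Sum>K\<in>B. f (Sup K) - f (Inf K)) \<le> - r * (\<Sum>K\<in>B. Sup K - Inf K)"
    unfolding sum_distrib_left using B(2) by (intro sum_mono) fastforce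
  moreover have "r * (\<Sum>K\<in>A. Sup K - Inf K) + r * (\<Sum>K\<in>B. Sup K - Inf K) \<ge> r * s"
    unfolding distrib_left[symmetric] using lA lB e r by (intro mult_left_mono) auto
  ultimately show False using R(3)[of f] by simp
qed

text \<open>If a piece of \<open>E\<close> had measure \<open>s > 0\<close>, disjoint intervals of
  slope above \<open>2 / s\<close> and total length above \<open>s / 2\<close> would have increments
  adding up to at least 1. Cutting \<open>E\<close> down to balls of radius \<open>d / 3\<close>
  keeps that total length at most \<open>2 * d / 3\<close>, where absolute continuity allows only
  increments below 1.\<close>

lemma abs_continuous_on_infinite_slope_negligible:
  fixes f :: "real \<Rightarrow> real"
  assumes f: "abs_continuous_on a b f" and E: "E \<in> lmeasurable" "E \<subseteq> {a<..<b}"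
    and up: "\<And>x d q. x \<in> E \<Longrightarrow> d > 0 \<Longrightarrow> \<exists>u v. u < v \<and> x \<in> {u..v} \<and> v - u < d \<and> f v - f u > q * (v - u)"
  shows "negligible E"
proof -
  obtain d where d: "d > 0" and dd: "\<And>D. D division_of \<Union>D \<Longrightarrow> \<Union>D \<subseteq> {a..b} \<Longrightarrow>
      (\<Sum>K\<in>D. Sup K - Inf K) < d \<Longrightarrow> (\<Sum>K\<in>D. \<bar>f (Sup K) - f (Inf K)\<bar>) < 1"
    using abs_continuous_onD[OF f zero_less_one] by blast
  have "negligible (E \<inter> ball x (d / 3))" for x
  proof (rule ccontr)
    let ?E = "E \<inter> ball x (d / 3)"
    assume ne: "\<not> negligible ?E"
    have Em: "?E \<in> lmeasurable" using E by auto
    define s where "s = measure lebesgue ?E"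
    have s: "s > 0" using ne Em unfolding s_def
      by (metis measure_nonneg negligible_iff_measure order_le_less)
    have U: "open (ball x (d/3) \<inter> {a<..<b})" "?E \<subseteq> ball x (d/3) \<inter> {a<..<b}" using E by auto
    obtain A where A: "finite A" "\<And>K. K \<in> A \<Longrightarrow> \<exists>u v. u < v \<and> K = {u..v} \<and> K \<subseteq> ball x (d/3) \<inter> {a<..<b}
        \<and> f v - f u > (2 / s) * (v - u)"
      "pairwise disjnt A" "measure lebesgue (?E - \<Union>A) < s / 2"
    proof (rule Vitali_finite_intervals[OF Em U, of "s/2" "\<lambda>u v. f v - f u > (2 / s) * (v - u)"])
      show "0 < s / 2" using s by simp
      show "\<exists>u v. u < v \<and> x' \<in> {u..v} \<and> v - u < d' \<and> f v - f u > (2 / s) * (v - u)"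
        if "x' \<in> ?E" "d' > 0" for x' d'
        using up that by blast
    qed blast
    have A': "\<And>K. K \<in> A \<Longrightarrow> \<exists>u v. u < v \<and> K = {u..v}" using A(2) by blast
    note mA = measure_disjoint_intervals[OF A(1,3) A']
    have AD: "A division_of \<Union>A"
    proof (rule division_ofI)
      fix K assume K: "K \<in> A"
      then show "K \<subseteq> \<Union>A" "K \<noteq> {}" "\<exists>a b. K = cbox a b" using A'[OF K] by auto
      fix K' assume "K' \<in> A" "K \<noteq> K'"
      then have "K \<inter> K' = {}" using K A(3) by (auto simp: pairwise_def disjnt_def)
      then show "interior K \<inter> interior K' = {}" using interior_subset by blast
    qed (use A in auto)
    have "measure lebesgue (\<Union>A) \<le> measure lebesgue (ball x (d/3))" using mA(1) A(2)
      by (intro measure_mono_fmeasurable) (blast, auto)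
    also have "\<dots> = 2 * d / 3" using d by (simp add: ball_eq_greaterThanLessThan)
    finally have "(\<Sum>K\<in>A. Sup K - Inf K) < d" using mA(2) d by simp
    moreover have "\<Union>A \<subseteq> {a..b}" using A(2) by fastforce
    ultimately have "(\<Sum>K\<in>A. \<bar>f (Sup K) - f (Inf K)\<bar>) < 1" using dd AD by blast
    moreover have "(\<Sum>K\<in>A. f (Sup K) - f (Inf K)) \<le> (\<Sum>K\<in>A. \<bar>f (Sup K) - f (Inf K)\<bar>)"
      by (rule sum_mono) simp
    moreover have "(\<Sum>K\<in>A. f (Sup K) - f (Inf K)) \<ge> 2 / s * (\<Sum>K\<in>A. Sup K - Inf K)"
      unfolding sum_distrib_left using A(2) by (intro sum_mono) fastforce
    moreover have "(\<Sum>K\<in>A. Sup K - Inf K) > s / 2"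
      using measure_cover_lower[OF Em mA(1) A(4)] mA(2) by (simp add: s_def)
    then have "2 / s * (\<Sum>K\<in>A. Sup K - Inf K) \<ge> 1" using s by (simp add: field_simps)
    ultimately show False by simp
  qed
  \<comment> \<open>Negligibility is a local property, so the bound on balls suffices.\<close>
  then have *: "\<exists>W. openin (top_of_set E) W \<and> x \<in> W \<and> negligible W" if "x \<in> E" for x
    using that d by (intro exI[of _ "E \<inter> ball x (d / 3)"]) (simp add: openin_open_Int)
  show ?thesis
    by (rule iffD2[OF locally_negligible_alt]) (intro ballI *)
qed

text \<open>Constant continuation beyond the endpoints: it replaces a function that is controlled
  only on [a, b] by one that is continuous, hence Borel, on the whole line.\<close>

lemma continuous_on_clamp:
  fixes f :: "real \<Rightarrow> 'a::topological_space"
  assumes "continuous_on {a..b} f" "a \<le> b"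
  shows "continuous_on S (\<lambda>x. f (max a (min b x)))"
  by (rule continuous_on_compose2[OF assms(1)]) (use assms(2) in \<open>auto intro!: continuous_intros\<close>)

section \<open>Upper and lower derivates, and Lebesgue's differentiation theorem\<close>

lemma frequently_at_0_iff:
  "(\<exists>\<^sub>F h in at (0::real). P h) \<longleftrightarrow> (\<forall>n::nat. \<exists>h. h \<noteq> 0 \<and> \<bar>h\<bar> < 1 / (Suc n) \<and> P h)"
proof -
  have "(\<exists>\<^sub>F h in at (0::real). P h) \<longleftrightarrow> (\<forall>d>0. \<exists>h. h \<noteq> 0 \<and> \<bar>h\<bar> < d \<and> P h)"
    unfolding frequently_def eventually_at by (auto simp: dist_real_def)
  also have "\<dots> \<longleftrightarrow> (\<forall>n::nat. \<exists>h. h \<noteq> 0 \<and> \<bar>h\<bar> < 1 / (Suc n) \<and> P h)"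
  proof (intro iffI allI impI)
    fix d :: real assume *: "\<forall>n::nat. \<exists>h. h \<noteq> 0 \<and> \<bar>h\<bar> < 1 / (Suc n) \<and> P h" and "d > 0"
    then obtain n where "1 / real (Suc n) < d" using nat_approx_posE by metis
    with * show "\<exists>h. h \<noteq> 0 \<and> \<bar>h\<bar> < d \<and> P h" by (meson less_trans)
  qed auto
  finally show ?thesis .
qed

text \<open>Up to the borderline case of equality, the points where the upper two-sided derivate of
  \<open>g\<close> exceeds \<open>q\<close>; applied to \<open>-g\<close> it describes the lower
  derivate. Phrasing it with \<open>frequently\<close> instead of \<open>Limsup\<close> exposes the
  points \<open>x + h\<close> that bound the steep intervals.\<close>

definition steep_points :: "(real \<Rightarrow> real) \<Rightarrow> real \<Rightarrow> real set" where
  "steep_points g q = {x. \<exists>\<^sub>F h in at 0. (g (x + h) - g x) / h > q}"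

text \<open>A G-delta set: radii \<open>1 / (n + 1)\<close> suffice, so the intersection is
  countable, and the uncountable union over \<open>h\<close> is harmless because each set in it is
  open.\<close>

lemma steep_points_borel:
  assumes "continuous_on UNIV g"
  shows "steep_points g q \<in> sets borel"
proof -
  have eq: "steep_points g q = (\<Inter>n::nat. \<Union>h\<in>{h. h \<noteq> 0 \<and> \<bar>h\<bar> < 1 / (Suc n)}. {x. (g (x + h) - g x) / h > q})"
    unfolding steep_points_def frequently_at_0_iff by auto
  have op: "open {x. (g (x + h) - g x) / h > q}" if "h \<noteq> 0" for h using that
    by (intro open_Collect_less continuous_intros continuous_on_compose2[OF assms]) auto
  show ?thesis unfolding eq
    by (rule sets.countable_INT'') (auto intro!: borel_open open_UN op)
qed

lemma steep_points_interval:
  assumes "x \<in> steep_points g q" "d > 0"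
  shows "\<exists>u v. u < v \<and> x \<in> {u..v} \<and> v - u < d \<and> g v - g u > q * (v - u)"
proof -
  have "\<exists>\<^sub>F h in at 0. (g (x + h) - g x) / h > q" using assms(1) by (simp add: steep_points_def)
  moreover have "\<forall>\<^sub>F h in at 0. h \<noteq> 0 \<and> \<bar>h\<bar> < d" using assms(2)
    unfolding eventually_at by (auto simp: dist_real_def)
  ultimately have "\<exists>\<^sub>F h in at 0. (g (x + h) - g x) / h > q \<and> h \<noteq> 0 \<and> \<bar>h\<bar> < d"
    by (rule frequently_eventually_frequently)
  then obtain h where h: "(g (x + h) - g x) / h > q" "h \<noteq> 0" "\<bar>h\<bar> < d"
    using frequently_ex by blast
  show ?thesis
  proof (cases "h > 0")
    case True
    then show ?thesis using h by (intro exI[of _ x] exI[of _ "x + h"]) (auto simp: field_simps)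
  next
    case False
    then show ?thesis using h by (intro exI[of _ "x + h"] exI[of _ x]) (auto simp: field_simps)
  qed
qed

text \<open>The first two assumptions confine the upper and lower limits of the difference quotient
  to a bounded range. If they differed, two rationals \<open>p < q\<close> would fit strictly
  between them, against the third assumption. Equal finite limits are a derivative.\<close>

lemma differentiable_if_not_steep:
  fixes g :: "real \<Rightarrow> real"
  assumes 1: "x \<notin> steep_points g m" and 2: "x \<notin> steep_points (\<lambda>t. - g t) m"
    and 3: "\<And>p q. p \<in> \<rat> \<Longrightarrow> q \<in> \<rat> \<Longrightarrow> p < q \<Longrightarrow> x \<notin> steep_points g q \<or> x \<notin> steep_points (\<lambda>t. - g t) (- p)"
  shows "g differentiable (at x)"
proof -
  define s where "s h = (g (x + h) - g x) / h" for h
  have neg: "(g x - g (x + h)) / h = - s h" for h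
    by (simp add: s_def divide_inverse algebra_simps)
  have le: "\<forall>\<^sub>F h in at 0. s h \<le> q" if "x \<notin> steep_points g q" for q
    using that by (simp add: steep_points_def frequently_def not_less s_def)
  have ge: "\<forall>\<^sub>F h in at 0. s h \<ge> - q" if "x \<notin> steep_points (\<lambda>t. - g t) q" for q
    using that by (simp add: steep_points_def frequently_def neg not_less minus_le_iff)
  let ?L = "Limsup (at 0) (\<lambda>h. ereal (s h))" and ?l = "Liminf (at 0) (\<lambda>h. ereal (s h))"
  have nt: "at (0::real) \<noteq> bot" by simp
  have L: "?L \<le> ereal m" using le[OF 1] by (intro Limsup_bounded) simp
  have l: "ereal (- m) \<le> ?l" using ge[OF 2] by (intro Liminf_bounded) simp
  have lL: "?l \<le> ?L" by (rule Liminf_le_Limsup[OF nt])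
  have "?L \<le> ?l"
  proof (rule ccontr)
    assume "\<not> ?L \<le> ?l"
    then have "?l < ?L" by simp
    obtain L' l' where r: "?L = ereal L'" "?l = ereal l'" using L l lL
      by (cases ?L; cases ?l) auto
    with \<open>?l < ?L\<close> have "l' < L'" by simp
    then obtain p where p: "p \<in> \<rat>" "l' < p" "p < L'" using Rats_dense_in_real by blast
    obtain q where q: "q \<in> \<rat>" "p < q" "q < L'" using Rats_dense_in_real[OF p(3)] by blast
    consider "x \<notin> steep_points g q" | "x \<notin> steep_points (\<lambda>t. - g t) (- p)" using 3[OF p(1) q(1,2)] by blast
    then show False
    proof cases
      case 1
      then have "?L \<le> ereal q" using le[OF 1] by (intro Limsup_bounded) simp
      then show False using r q by simp
    next
      case 2
      then have "ereal p \<le> ?l" using ge[OF 2] by (intro Liminf_bounded) simp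
      then show False using r p by simp
    qed
  qed
  with lL have eq: "?l = ?L" by simp
  obtain L' where r: "?L = ereal L'" using L l lL by (cases ?L; cases ?l) auto
  have "((\<lambda>h. ereal (s h)) \<longlongrightarrow> ereal L') (at 0)"
    using eq r tendsto_iff_Liminf_eq_Limsup[OF nt] by metis
  then have "(s \<longlongrightarrow> L') (at 0)" by simp
  then have "(g has_field_derivative L') (at x)" by (simp add: DERIV_def s_def[abs_def])
  then show ?thesis using real_differentiable_def by blast
qed

lemma abs_continuous_on_differentiable_ae:
  assumes f: "abs_continuous_on a b f" and "a \<le> b"
  shows "negligible {x\<in>{a..b}. \<not> f differentiable (at x)}"
proof -
  define g where "g x = f (max a (min b x))" for x
  have gc: "continuous_on UNIV g" unfolding g_def
    by (rule continuous_on_clamp[OF abs_continuous_on_imp_continuous_on[OF f] assms(2)])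
  have gf: "abs_continuous_on a b g"
    by (rule abs_continuous_on_cong[OF _ f]) (auto simp: g_def)
  let ?S = "steep_points g" and ?T = "steep_points (\<lambda>t. - g t)"
  have Sb: "?S q \<in> sets borel" "?T q \<in> sets borel" for q
    by (intro steep_points_borel continuous_intros gc)+
  have lm: "X \<inter> {a<..<b} \<in> lmeasurable" if "X \<in> sets borel" for X
    using that by (intro bounded_set_imp_lmeasurable) (auto intro: bounded_subset[of "{a..b}"])
  have N1: "negligible (?S q \<inter> ?T (- p) \<inter> {a<..<b})" if "p < q" for p q
  proof (rule abs_continuous_on_steep_negligible)
    \<comment> \<open>Subtracting the line of slope \<open>(p + q) / 2\<close> makes the situation
      symmetric: slopes above \<open>q\<close> and below \<open>p\<close> become slopes above
      \<open>r\<close> and below \<open>-r\<close> with \<open>r = (q - p) / 2\<close>.\<close>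
    let ?h = "\<lambda>x. g x + - ((p + q) / 2 * x)"
    show "abs_continuous_on a b ?h"
    proof (intro abs_continuous_on_add gf lipschitz_on_imp_abs_continuous_on lipschitz_onI)
      fix x y :: real
      have *: "- (c * x) - - (c * y) = - c * (x - y)" for c by (simp add: algebra_simps)
      show "dist (- ((p + q) / 2 * x)) (- ((p + q) / 2 * y)) \<le> \<bar>(p + q) / 2\<bar> * dist x y"
        unfolding dist_real_def * by (simp only: abs_mult abs_minus_cancel)
    qed simp
    show "?S q \<inter> ?T (- p) \<inter> {a<..<b} \<in> lmeasurable" using lm Sb by blast
    show "0 < (q - p) / 2" using that by simp
    fix x d :: real assume x: "x \<in> ?S q \<inter> ?T (- p) \<inter> {a<..<b}" "d > 0"
    have E: "(?h v - ?h u) = g v - g u - (p + q) / 2 * (v - u)" for u v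
      unfolding right_diff_distrib by simp
    have M: "(q - p) / 2 * w = q * w - (p + q) / 2 * w" "- ((q - p) / 2) * w = p * w - (p + q) / 2 * w" for w
      by (simp_all add: field_simps)
    obtain u v where "u < v" "x \<in> {u..v}" "v - u < d" "g v - g u > q * (v - u)"
      using steep_points_interval[of x g q d] x by blast
    then show "\<exists>u v. u < v \<and> x \<in> {u..v} \<and> v - u < d \<and> ?h v - ?h u > (q - p) / 2 * (v - u)"
      unfolding E M by (intro exI[of _ u] exI[of _ v]) simp
    obtain u v where "u < v" "x \<in> {u..v}" "v - u < d" "- g v - - g u > - p * (v - u)"
      using steep_points_interval[of x "\<lambda>t. - g t" "- p" d] x by blast
    then show "\<exists>u v. u < v \<and> x \<in> {u..v} \<and> v - u < d \<and> ?h v - ?h u < - ((q - p) / 2) * (v - u)"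
      unfolding E M by (intro exI[of _ u] exI[of _ v]) simp
  qed auto
  have N2: "negligible ((\<Inter>n::nat. ?S n) \<inter> {a<..<b})"
  proof (rule abs_continuous_on_infinite_slope_negligible[OF gf])
    show "(\<Inter>n::nat. ?S n) \<inter> {a<..<b} \<in> lmeasurable"
      by (intro lm sets.countable_INT'' Sb) auto
    fix x d q :: real assume x: "x \<in> (\<Inter>n::nat. ?S n) \<inter> {a<..<b}" "d > 0"
    obtain n :: nat where n: "q \<le> n" using real_arch_simple by blast
    have xn: "x \<in> ?S (real n)" using x(1) by simp
    obtain u v where "u < v" "x \<in> {u..v}" "v - u < d" "g v - g u > real n * (v - u)"
      using steep_points_interval[OF xn x(2)] by blast
    moreover from this n have "q * (v - u) \<le> real n * (v - u)" by (intro mult_right_mono) auto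
    ultimately have "q * (v - u) < g v - g u" by linarith
    with \<open>u < v\<close> \<open>x \<in> {u..v}\<close> \<open>v - u < d\<close>
    show "\<exists>u v. u < v \<and> x \<in> {u..v} \<and> v - u < d \<and> q * (v - u) < g v - g u" by blast
  qed auto
  have N3: "negligible ((\<Inter>n::nat. ?T n) \<inter> {a<..<b})"
  proof (rule abs_continuous_on_infinite_slope_negligible[OF abs_continuous_on_uminus[OF gf]])
    show "(\<Inter>n::nat. ?T n) \<inter> {a<..<b} \<in> lmeasurable"
      by (intro lm sets.countable_INT'' Sb) auto
    fix x d q :: real assume x: "x \<in> (\<Inter>n::nat. ?T n) \<inter> {a<..<b}" "d > 0"
    obtain n :: nat where n: "q \<le> n" using real_arch_simple by blast
    have xn: "x \<in> ?T (real n)" using x(1) by simp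
    obtain u v where "u < v" "x \<in> {u..v}" "v - u < d" "- g v - - g u > real n * (v - u)"
      using steep_points_interval[OF xn x(2)] by blast
    moreover from this n have "q * (v - u) \<le> real n * (v - u)" by (intro mult_right_mono) auto
    ultimately have "q * (v - u) < - g v - - g u" by linarith
    with \<open>u < v\<close> \<open>x \<in> {u..v}\<close> \<open>v - u < d\<close>
    show "\<exists>u v. u < v \<and> x \<in> {u..v} \<and> v - u < d \<and> q * (v - u) < - g v - - g u" by blast
  qed auto
  \<comment> \<open>Exceptional points: the endpoints, those with an infinite derivate of either
    sign, and those whose derivates are separated by a rational pair. Rationals keep the last union
    countable.\<close>
  define Z where "Z = {a, b} \<union> (\<Inter>n::nat. ?S n) \<inter> {a<..<b} \<union> (\<Inter>n::nat. ?T n) \<inter> {a<..<b}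
    \<union> (\<Union>(p, q)\<in>{(p, q)\<in>\<rat>\<times>\<rat>. p < q}. ?S q \<inter> ?T (- p) \<inter> {a<..<b})"
  have "negligible Z" unfolding Z_def
  proof (intro negligible_Un N2 N3)
    show "negligible {a, b}" by (simp add: negligible_finite)
    have "countable {(p, q)\<in>\<rat>\<times>(\<rat>::real set). p < q}"
      by (rule countable_subset[of _ "\<rat>\<times>\<rat>"]) (auto simp: countable_rat)
    then show "negligible (\<Union>(p, q)\<in>{(p, q)\<in>\<rat>\<times>\<rat>. p < q}. ?S q \<inter> ?T (- p) \<inter> {a<..<b})"
      using N1 by (intro negligible_countable_Union) auto
  qed
  moreover have "f differentiable (at x)" if x: "x \<in> {a..b} - Z" for x
  proof -
    have xi: "x \<in> {a<..<b}" using x by (auto simp: Z_def)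
    obtain n m :: nat where nm: "x \<notin> ?S n" "x \<notin> ?T m" using x xi by (auto simp: Z_def)
    have mono: "x \<notin> steep_points k q'" if "x \<notin> steep_points k q" "q \<le> q'" for k q q'
      using that frequently_mono[of "\<lambda>h. (k (x + h) - k x) / h > q'" "\<lambda>h. (k (x + h) - k x) / h > q"]
      unfolding steep_points_def by auto
    have "g differentiable (at x)"
    proof (rule differentiable_if_not_steep)
      show "x \<notin> ?S (real (max n m))" "x \<notin> ?T (real (max n m))" using mono nm by (meson max.cobounded1 max.cobounded2 of_nat_le_iff)+
      show "x \<notin> ?S q \<or> x \<notin> ?T (- p)" if "p \<in> \<rat>" "q \<in> \<rat>" "p < q" for p q
        using x xi that by (auto simp: Z_def)
    qed
    then obtain D where "(g has_derivative D) (at x)" by (auto simp: differentiable_def)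
    \<comment> \<open>\<open>g\<close> agrees with \<open>f\<close> near interior points only; this
      is why \<open>Z\<close> contains \<open>a\<close> and \<open>b\<close>.\<close>
    then have "(f has_derivative D) (at x)"
      by (rule has_derivative_transform_within_open[of _ _ _ _ "{a<..<b}"]) (use xi in \<open>auto simp: g_def\<close>)
    then show ?thesis by (auto simp: differentiable_def)
  qed
  then have "{x\<in>{a..b}. \<not> f differentiable (at x)} \<subseteq> Z" by blast
  ultimately show ?thesis by (rule negligible_subset)
qed

section \<open>Fractional integrals of continuous functions\<close>

lemma continuous_on_imp_abs_bound:
  fixes f :: "real \<Rightarrow> real"
  assumes "continuous_on {a..b} f"
  obtains M where "M \<ge> 0" "\<And>x. x \<in> {a..b} \<Longrightarrow> \<bar>f x\<bar> \<le> M"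
proof -
  have "bounded (f ` {a..b})"
    using assms by (intro compact_imp_bounded compact_continuous_image) auto
  then obtain M where "\<And>x. x \<in> {a..b} \<Longrightarrow> \<bar>f x\<bar> \<le> M" unfolding bounded_iff by (auto simp del: atLeastAtMost_iff)
  then show ?thesis by (intro that[of "max M 0"]) (auto simp: le_max_iff_disj)
qed

lemma continuous_mult_absolutely_integrable:
  fixes f :: "real \<Rightarrow> real"
  assumes f: "continuous_on {a..b} f" and k: "k absolutely_integrable_on {a..b}"
  shows "(\<lambda>t. k t * f t) absolutely_integrable_on {a..b}"
proof -
  have "bounded (f ` {a..b})"
    using f by (intro compact_imp_bounded compact_continuous_image) auto
  then have "(\<lambda>t. f t * k t) absolutely_integrable_on {a..b}"
    using f k by (intro absolutely_integrable_bounded_measurable_product_real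
        continuous_imp_measurable_on_sets_lebesgue) auto
  then show ?thesis by (simp add: mult.commute)
qed

lemma kernel_absolutely_integrable_0:
  fixes \<gamma> c :: real
  assumes "\<gamma> > 0"
  shows "(\<lambda>s. s powr (\<gamma> - 1)) absolutely_integrable_on {0..c}"
proof (cases "c \<ge> 0")
  case True
  then show ?thesis using has_integral_powr_from_0[of "\<gamma> - 1" c] assms
    by (intro nonnegative_absolutely_integrable_1) auto
qed simp

lemma right_kernel_absolutely_integrable:
  fixes \<gamma> x b :: real
  assumes "\<gamma> > 0"
  shows "(\<lambda>t. (t - x) powr (\<gamma> - 1)) absolutely_integrable_on {x..b}"
proof -
  have "(\<lambda>s. s powr (\<gamma> - 1)) integrable_on cbox 0 (b - x)"
    using kernel_absolutely_integrable_0[OF assms, of "b - x"]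
    by (simp add: set_lebesgue_integral_eq_integral)
  from integrable_on_affinity[OF _ this, of 1 "- x"]
  have "(\<lambda>t. (t - x) powr (\<gamma> - 1)) integrable_on {x..b}" by (simp add: image_add_atLeastAtMost' o_def)
  then show ?thesis by (rule nonnegative_absolutely_integrable_1) simp
qed

lemma rl_right_absolutely_integrable:
  fixes f :: "real \<Rightarrow> real"
  assumes "\<gamma> > 0" "continuous_on {x..b} f"
  shows "(\<lambda>t. (t - x) powr (\<gamma> - 1) * f t) absolutely_integrable_on {x..b}"
  by (rule continuous_mult_absolutely_integrable[OF assms(2) right_kernel_absolutely_integrable[OF assms(1)]])

text \<open>The substitution \<open>t = x + s * (b - x)\<close> frees both the domain and the
  singular factor from \<open>x\<close>, which then enters only through the continuous
  \<open>f\<close> and a power of \<open>b - x\<close>.\<close>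

lemma rl_right_kernel_integral_scaled:
  fixes f :: "real \<Rightarrow> real"
  assumes g: "\<gamma> > 0" and f: "continuous_on {x..b} f" and x: "x \<le> b"
  shows "integral {x..b} (\<lambda>t. (t - x) powr (\<gamma> - 1) * f t) =
    (b - x) powr \<gamma> * integral {0..1} (\<lambda>s. s powr (\<gamma> - 1) * f (x + s * (b - x)))"
proof (cases "x = b")
  case False
  define m where "m = b - x"
  have m: "m > 0" "m \<noteq> 0" using False x by (auto simp: m_def)
  let ?F = "\<lambda>t. (t - x) powr (\<gamma> - 1) * f t"
  let ?I = "integral {x..b} ?F"
  have "?F integrable_on {x..b}" using rl_right_absolutely_integrable[OF g f]
    by (simp add: set_lebesgue_integral_eq_integral)
  then have "(?F has_integral ?I) (cbox x b)" by (simp add: integrable_integral)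
  from has_integral_affinity[OF this m(2), of x]
  have 1: "((\<lambda>s. (m * s) powr (\<gamma> - 1) * f (m * s + x)) has_integral (1 / m) * ?I)
     ((\<lambda>t. (1 / m) * t + - ((1 / m) * x)) ` {x..b})" using m by simp
  have img: "(\<lambda>t. (1 / m) * t + - ((1 / m) * x)) ` {x..b} = {0..1}"
    using m x image_affinity_atLeastAtMost[of "1 / m" "- ((1 / m) * x)" x b]
    by (simp add: m_def diff_divide_distrib[symmetric])
  have "(1 / m) * ?I = integral {0..1} (\<lambda>s. (m * s) powr (\<gamma> - 1) * f (m * s + x))"
    using 1 unfolding img by (simp add: integral_unique)
  also have "\<dots> = integral {0..1} (\<lambda>s. m powr (\<gamma> - 1) * (s powr (\<gamma> - 1) * f (x + s * (b - x))))"
    using m by (intro integral_cong) (simp add: powr_mult m_def mult_ac add_ac)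
  also have "\<dots> = m powr (\<gamma> - 1) * integral {0..1} (\<lambda>s. s powr (\<gamma> - 1) * f (x + s * (b - x)))"
    by simp
  finally have "?I = m * m powr (\<gamma> - 1) * integral {0..1} (\<lambda>s. s powr (\<gamma> - 1) * f (x + s * (b - x)))"
    using m by (simp add: field_simps)
  moreover have "m * m powr (\<gamma> - 1) = m powr \<gamma>" using m by (simp add: powr_mult_base)
  ultimately show ?thesis by (simp add: m_def)
qed simp

text \<open>In scaled form the integrands are dominated by \<open>M\<close> times a fixed integrable
  kernel, so dominated convergence applies along sequences. The factor
  \<open>(b - x) powr \<gamma>\<close> is continuous down to 0 since \<gamma> is positive, which
  covers \<open>x = b\<close>.\<close>

lemma continuous_on_rl_right_kernel_integral:
  fixes f :: "real \<Rightarrow> real"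
  assumes g: "\<gamma> > 0" and f: "continuous_on {a..b} f"
  shows "continuous_on {a..b} (\<lambda>x. integral {x..b} (\<lambda>t. (t - x) powr (\<gamma> - 1) * f t))"
proof -
  obtain M where M: "M \<ge> 0" "\<And>x. x \<in> {a..b} \<Longrightarrow> \<bar>f x\<bar> \<le> M"
    using continuous_on_imp_abs_bound[OF f] by blast
  have seg: "x + s * (b - x) \<in> {a..b}" if "x \<in> {a..b}" "s \<in> {0..1}" for x s :: real
  proof -
    have "0 \<le> s * (b - x)" "s * (b - x) \<le> 1 * (b - x)" using that by (intro mult_nonneg_nonneg mult_right_mono; simp)+
    then show ?thesis using that by simp
  qed
  have k: "(\<lambda>s. s powr (\<gamma> - 1)) absolutely_integrable_on {0..1}" by (rule kernel_absolutely_integrable_0[OF g])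
  have c: "continuous_on {a..b} (\<lambda>x. integral {0..1} (\<lambda>s. s powr (\<gamma> - 1) * f (x + s * (b - x))))"
    unfolding continuous_on_sequentially
  proof (intro allI ballI impI)
    fix X x assume x: "x \<in> {a..b}" and X: "(\<forall>n. X n \<in> {a..b}) \<and> X \<longlonglongrightarrow> x"
    have "(\<lambda>n. integral {0..1} (\<lambda>s. s powr (\<gamma> - 1) * f (X n + s * (b - X n)))) \<longlonglongrightarrow>
       integral {0..1} (\<lambda>s. s powr (\<gamma> - 1) * f (x + s * (b - x)))"
    proof (rule dominated_convergence(2))
      show "(\<lambda>s. s powr (\<gamma> - 1) * f (X n + s * (b - X n))) integrable_on {0..1}" for n
      proof (rule set_lebesgue_integral_eq_integral(1), rule continuous_mult_absolutely_integrable[OF _ k])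
        show "continuous_on {0..1} (\<lambda>s. f (X n + s * (b - X n)))"
          using X seg by (intro continuous_on_compose2[OF f] continuous_intros) auto
      qed
      show "(\<lambda>s. s powr (\<gamma> - 1) * M) integrable_on {0..1}"
        using k by (intro integrable_on_mult_left set_lebesgue_integral_eq_integral(1))
      show "norm (s powr (\<gamma> - 1) * f (X n + s * (b - X n))) \<le> s powr (\<gamma> - 1) * M" if "s \<in> {0..1}" for n s
        unfolding real_norm_def abs_mult using M(2) seg X that by (auto intro!: mult_left_mono)
      show "(\<lambda>n. s powr (\<gamma> - 1) * f (X n + s * (b - X n))) \<longlonglongrightarrow> s powr (\<gamma> - 1) * f (x + s * (b - x))"
        if "s \<in> {0..1}" for s
      proof (rule tendsto_mult_left, rule continuous_on_tendsto_compose[OF f])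
        show "(\<lambda>n. X n + s * (b - X n)) \<longlonglongrightarrow> x + s * (b - x)" using X by (intro tendsto_intros) auto
      qed (use seg x X that in auto)
    qed
    then show "((\<lambda>x. integral {0..1} (\<lambda>s. s powr (\<gamma> - 1) * f (x + s * (b - x)))) \<circ> X)
      \<longlonglongrightarrow> integral {0..1} (\<lambda>s. s powr (\<gamma> - 1) * f (x + s * (b - x)))" by (simp add: o_def)
  qed
  have "continuous_on {a..b} (\<lambda>x. (b - x) powr \<gamma> * integral {0..1} (\<lambda>s. s powr (\<gamma> - 1) * f (x + s * (b - x))))"
    using g by (intro continuous_on_mult c continuous_on_powr' continuous_intros) auto
  then show ?thesis
    by (rule continuous_on_eq) (use g f in \<open>auto intro!: rl_right_kernel_integral_scaled[symmetric] intro: continuous_on_subset\<close>)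
qed

lemma continuous_on_rl_right_integral:
  assumes "\<gamma> > 0" "continuous_on {a..b} f"
  shows "continuous_on {a..b} (rl_right_integral b \<gamma> f)"
  unfolding rl_right_integral_def[abs_def]
  by (intro continuous_on_mult continuous_on_const continuous_on_rl_right_kernel_integral assms)

lemma rl_left_absolutely_integrable:
  fixes f :: "real \<Rightarrow> real"
  assumes "\<gamma> > 0" "continuous_on {a..x} f"
  shows "(\<lambda>t. (x - t) powr (\<gamma> - 1) * f t) absolutely_integrable_on {a..x}"
proof -
  have "continuous_on {- x..- a} (\<lambda>t. f (- t))"
    by (intro continuous_on_compose2[OF assms(2)] continuous_intros) (auto simp: minus_le_iff le_minus_iff)
  from rl_right_absolutely_integrable[OF assms(1) this]
  have "(\<lambda>t. (\<lambda>t. (x - t) powr (\<gamma> - 1) * f t) (- t)) absolutely_integrable_on {- x..- a}"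
    by (simp add: add.commute)
  then show ?thesis by (subst (asm) absolutely_integrable_reflect_real)
qed

text \<open>Through the reflection of the axis, continuity of left integrals is inherited from right
  ones.\<close>

lemma rl_left_integral_reflect:
  "rl_left_integral a \<gamma> f x = rl_right_integral (- a) \<gamma> (\<lambda>t. f (- t)) (- x)"
  unfolding rl_left_integral_def rl_right_integral_def
  using Henstock_Kurzweil_Integration.integral_reflect_real[of x a "\<lambda>t. (x - t) powr (\<gamma> - 1) * f t"]
  by (simp add: add.commute)

lemma continuous_on_rl_left_integral:
  assumes "\<gamma> > 0" "continuous_on {a..b} f"
  shows "continuous_on {a..b} (rl_left_integral a \<gamma> f)"
proof -
  have "continuous_on {- b..- a} (\<lambda>t. f (- t))"
    by (intro continuous_on_compose2[OF assms(2)] continuous_intros) (auto simp: minus_le_iff le_minus_iff)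
  from continuous_on_rl_right_integral[OF assms(1) this]
  show ?thesis unfolding rl_left_integral_reflect[abs_def]
    by (rule continuous_on_compose2) (auto intro!: continuous_intros)
qed

text \<open>The bridge from gauge integrals over an interval to integrals against
  \<open>lborel\<close>, on whose product Fubini's theorem is used. Borel measurability is what
  allows the step down from the completed measure.\<close>

lemma integral_indicator_lborel:
  fixes f :: "real \<Rightarrow> real"
  assumes f: "f \<in> borel_measurable borel" and i: "f absolutely_integrable_on {a..b}"
  shows "integrable lborel (\<lambda>x. indicator {a..b} x * f x)"
    "integral\<^sup>L lborel (\<lambda>x. indicator {a..b} x * f x) = integral {a..b} f"
proof -
  have *: "(\<lambda>x. indicator {a..b} x * f x) \<in> borel_measurable lborel" using f by measurable
  have "integrable (completion lborel) (\<lambda>x. indicator {a..b} x * f x)"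
    using i by (simp add: set_integrable_def)
  then show 1: "integrable lborel (\<lambda>x. indicator {a..b} x * f x)"
    using integrable_completion[OF *] by simp
  then show "integral\<^sup>L lborel (\<lambda>x. indicator {a..b} x * f x) = integral {a..b} f"
    using set_borel_integral_eq_integral(2)[of "{a..b}" f]
    by (simp add: set_integrable_def set_lebesgue_integral_def)
qed

lemma fractional_integration_by_parts_UNIV:
  fixes F G :: "real \<Rightarrow> real"
  assumes g: "\<gamma> > 0" and F: "continuous_on UNIV F" and G: "continuous_on UNIV G"
  shows "integral {a..b} (\<lambda>x. F x * rl_left_integral a \<gamma> G x) =
    integral {a..b} (\<lambda>t. rl_right_integral b \<gamma> F t * G t)"
proof -
  \<comment> \<open>The kernel lives on the triangle \<open>a \<le> t \<le> x \<le> b\<close>, whose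
    two orders of integration give the two sides. It takes \<open>F\<close> and \<open>G\<close> as
    arguments so that it can be reused for their absolute values.\<close>
  define k where "k F G = (\<lambda>x t. (if a \<le> t \<and> t \<le> x \<and> x \<le> b then (x - t) powr (\<gamma> - 1) * F x * G t else 0 :: real))" for F G :: "real \<Rightarrow> real"
  note cs = continuous_on_subset[OF _ subset_UNIV]
  have km: "case_prod (k F G) \<in> borel_measurable (borel \<Otimes>\<^sub>M borel)"
    if "continuous_on UNIV F" "continuous_on UNIV G" for F G
  proof -
    have [measurable]: "F \<in> borel_measurable borel" "G \<in> borel_measurable borel"
      using that by (auto intro: borel_measurable_continuous_onI)
    show ?thesis unfolding k_def by measurable
  qed
  have inner1: "integrable lborel (\<lambda>t. k F G x t)"
    "integral\<^sup>L lborel (\<lambda>t. k F G x t) = indicator {a..b} x * (Gamma \<gamma> * (F x * rl_left_integral a \<gamma> G x))"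
    if FG: "continuous_on UNIV F" "continuous_on UNIV G" for F G x
  proof -
    have [measurable]: "F \<in> borel_measurable borel" "G \<in> borel_measurable borel"
      using FG by (auto intro: borel_measurable_continuous_onI)
    let ?f = "\<lambda>t. F x * ((x - t) powr (\<gamma> - 1) * G t)"
    have m: "?f \<in> borel_measurable borel" by measurable
    have i: "?f absolutely_integrable_on {a..x}"
      by (intro set_integrable_mult_right rl_left_absolutely_integrable g cs[OF FG(2)])
    have eq: "k F G x = (\<lambda>t. indicator {a..b} x * (indicator {a..x} t * ?f t))"
      by (auto simp: k_def indicator_def fun_eq_iff)
    show "integrable lborel (\<lambda>t. k F G x t)" unfolding eq
      by (intro integrable_mult_right integral_indicator_lborel(1)[OF m i])
    show "integral\<^sup>L lborel (\<lambda>t. k F G x t) = indicator {a..b} x * (Gamma \<gamma> * (F x * rl_left_integral a \<gamma> G x))"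
      unfolding eq using integral_indicator_lborel(2)[OF m i] Gamma_real_pos[OF g]
      by (simp add: rl_left_integral_def)
  qed
  have inner2: "integral\<^sup>L lborel (\<lambda>x. k F G x t) = indicator {a..b} t * (Gamma \<gamma> * (rl_right_integral b \<gamma> F t * G t))"
    for t
  proof -
    have [measurable]: "F \<in> borel_measurable borel"
      using F by (auto intro: borel_measurable_continuous_onI)
    let ?f = "\<lambda>x. G t * ((x - t) powr (\<gamma> - 1) * F x)"
    have m: "?f \<in> borel_measurable borel" by measurable
    have i: "?f absolutely_integrable_on {t..b}"
      by (intro set_integrable_mult_right rl_right_absolutely_integrable g cs[OF F])
    have eq: "(\<lambda>x. k F G x t) = (\<lambda>x. indicator {a..b} t * (indicator {t..b} x * ?f x))"
      by (auto simp: k_def indicator_def fun_eq_iff)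
    show ?thesis
      unfolding eq using integral_indicator_lborel(2)[OF m i] Gamma_real_pos[OF g]
      by (simp add: rl_right_integral_def)
  qed
  \<comment> \<open>The norm of the kernel is again a kernel of the same shape, so
    \<open>inner1\<close> and \<open>outer\<close> for the absolute values supply the integrability
    that Fubini's theorem demands.\<close>
  have nk: "norm (case_prod (k F G) (x, t)) = k (\<lambda>x. \<bar>F x\<bar>) (\<lambda>x. \<bar>G x\<bar>) x t" for x t
    by (simp add: k_def abs_mult)
  have outer: "integrable lborel (\<lambda>x. indicator {a..b} x * (Gamma \<gamma> * (F x * rl_left_integral a \<gamma> G x)))"
    if FG: "continuous_on UNIV F" "continuous_on UNIV G" for F G
    using borel_integrable_atLeastAtMost'[of a b "\<lambda>x. Gamma \<gamma> * (F x * rl_left_integral a \<gamma> G x)"]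
    by (simp add: set_integrable_def continuous_on_mult continuous_on_rl_left_integral[OF g] cs FG)
  have "integrable (lborel \<Otimes>\<^sub>M lborel) (case_prod (k F G))"
  proof (rule lborel_pair.Fubini_integrable)
    show "case_prod (k F G) \<in> borel_measurable (lborel \<Otimes>\<^sub>M lborel)" using km[OF F G] by simp
    have "continuous_on UNIV (\<lambda>x. \<bar>F x\<bar>)" "continuous_on UNIV (\<lambda>x. \<bar>G x\<bar>)"
      using F G by (auto intro!: continuous_intros)
    then show "integrable lborel (\<lambda>x. LBINT t. norm (case_prod (k F G) (x, t)))"
      unfolding nk by (simp add: inner1 outer)
    show "AE x in lborel. integrable lborel (\<lambda>t. case_prod (k F G) (x, t))"
      using inner1(1)[OF F G] by simp
  qed
  from lborel_pair.Fubini_integral[OF this]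
  have "integral\<^sup>L lborel (\<lambda>t. indicator {a..b} t * (Gamma \<gamma> * (rl_right_integral b \<gamma> F t * G t))) =
    integral\<^sup>L lborel (\<lambda>x. indicator {a..b} x * (Gamma \<gamma> * (F x * rl_left_integral a \<gamma> G x)))"
    unfolding inner1(2)[OF F G] inner2 .
  moreover have "integral\<^sup>L lborel (\<lambda>t. indicator {a..b} t * H t) = integral {a..b} H"
    if "continuous_on {a..b} H" for H :: "real \<Rightarrow> real"
    using set_borel_integral_eq_integral(2)[OF borel_integrable_atLeastAtMost'[OF that]]
    by (simp add: set_lebesgue_integral_def)
  ultimately have "integral {a..b} (\<lambda>t. Gamma \<gamma> * (rl_right_integral b \<gamma> F t * G t)) =
     integral {a..b} (\<lambda>x. Gamma \<gamma> * (F x * rl_left_integral a \<gamma> G x))"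
    using F G by (simp add: continuous_on_mult continuous_on_rl_left_integral[OF g] continuous_on_rl_right_integral[OF g] cs)
  then show ?thesis using Gamma_real_pos[OF g] by simp
qed

lemma rl_left_integral_cong:
  "(\<And>t. t \<in> {a..x} \<Longrightarrow> f t = g t) \<Longrightarrow> rl_left_integral a \<gamma> f x = rl_left_integral a \<gamma> g x"
  unfolding rl_left_integral_def by (metis (no_types, lifting) Henstock_Kurzweil_Integration.integral_cong)

lemma rl_right_integral_cong:
  "(\<And>t. t \<in> {x..b} \<Longrightarrow> f t = g t) \<Longrightarrow> rl_right_integral b \<gamma> f x = rl_right_integral b \<gamma> g x"
  unfolding rl_right_integral_def by (metis (no_types, lifting) Henstock_Kurzweil_Integration.integral_cong)

text \<open>Both sides see only values on [a, b], so the clamped functions may stand in for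
  \<open>f\<close> and \<open>g\<close>.\<close>

lemma fractional_integration_by_parts:
  fixes f g :: "real \<Rightarrow> real"
  assumes "\<gamma> > 0" and f: "continuous_on {a..b} f" and g: "continuous_on {a..b} g"
  shows "integral {a..b} (\<lambda>x. f x * rl_left_integral a \<gamma> g x) =
    integral {a..b} (\<lambda>t. rl_right_integral b \<gamma> f t * g t)"
proof (cases "a \<le> b")
  case True
  define F where "F x = f (max a (min b x))" for x
  define G where "G x = g (max a (min b x))" for x
  have FG: "F x = f x" "G x = g x" if "x \<in> {a..b}" for x using that by (auto simp: F_def G_def)
  have "integral {a..b} (\<lambda>x. f x * rl_left_integral a \<gamma> g x) = integral {a..b} (\<lambda>x. F x * rl_left_integral a \<gamma> G x)"
    by (intro Henstock_Kurzweil_Integration.integral_cong arg_cong2[where f="(*)"] rl_left_integral_cong) (auto simp: FG)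
  also have "\<dots> = integral {a..b} (\<lambda>t. rl_right_integral b \<gamma> F t * G t)"
    unfolding F_def G_def
    by (intro fractional_integration_by_parts_UNIV assms(1) continuous_on_clamp f g True)
  also have "\<dots> = integral {a..b} (\<lambda>t. rl_right_integral b \<gamma> f t * g t)"
    by (intro Henstock_Kurzweil_Integration.integral_cong arg_cong2[where f="(*)"] rl_right_integral_cong) (auto simp: FG)
  finally show ?thesis .
qed simp

section \<open>Differentiation under the integral sign\<close>

text \<open>Differentiability is given only relative to the strip, which is one-sided in the first
  coordinate at \<open>a\<close> and \<open>b\<close>. A curve that keeps \<open>x\<close> fixed
  never leaves the strip, so along it the chain rule still yields a two-sided derivative.\<close>

lemma has_real_derivative_along_fibre:
  fixes f :: "real \<times> 'e::real_normed_vector \<Rightarrow> real"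
  assumes f': "\<And>p. p \<in> {a..b} \<times> UNIV \<Longrightarrow> (f has_derivative blinfun_apply (f' p)) (at p within {a..b} \<times> UNIV)"
    and x: "x \<in> {a..b}" and c: "(c has_vector_derivative q) (at s)"
  shows "((\<lambda>s. f (x, c s)) has_real_derivative blinfun_apply (f' (x, c s)) (0, q)) (at s)"
proof -
  have 1: "((\<lambda>s. (x, c s)) has_derivative (\<lambda>h. (0, h *\<^sub>R q))) (at s)"
    using c unfolding has_vector_derivative_def by (intro has_derivative_Pair) auto
  have 2: "(f has_derivative blinfun_apply (f' (x, c s))) (at (x, c s) within range (\<lambda>s. (x, c s)))"
    by (rule has_derivative_subset[OF f']) (use x in auto)
  from diff_chain_within[OF 1 2]
  have "((\<lambda>s. f (x, c s)) has_derivative (\<lambda>h. blinfun_apply (f' (x, c s)) (0, h *\<^sub>R q))) (at s)"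
    by (simp add: o_def)
  moreover have "(0 :: real, h *\<^sub>R q) = h *\<^sub>R (0, q)" for h by simp
  ultimately have "((\<lambda>s. f (x, c s)) has_derivative (\<lambda>h. h *\<^sub>R blinfun_apply (f' (x, c s)) (0, q))) (at s)"
    by (simp only: blinfun.scaleR_right)
  then show ?thesis unfolding has_field_derivative_def by (simp add: mult.commute[of _ "blinfun_apply (f' (x, c s)) (0, q)"])
qed

lemma continuous_on_blinfun_apply_const:
  "continuous_on S f' \<Longrightarrow> continuous_on S (\<lambda>p. blinfun_apply (f' p) d)"
  by (intro continuous_intros)

text \<open>The partial derivatives, defined through \<open>deriv\<close>, are the values of the
  Frechet derivative on the unit vectors of the fibre. Their continuity follows, and linearity turns
  the derivative along a curve into the usual chain rule.\<close>

lemma C1_on_lag5: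
  assumes L: "C1_on ({a..b} \<times> UNIV) L"
  shows "continuous_on ({a..b} \<times> UNIV) L"
    "continuous_on ({a..b} \<times> UNIV) (dL_y L)" "continuous_on ({a..b} \<times> UNIV) (dL_v L)"
    "continuous_on ({a..b} \<times> UNIV) (dL_w L)" "continuous_on ({a..b} \<times> UNIV) (dL_z L)"
    "\<And>x py pv pw pz qy qv qw qz s. x \<in> {a..b} \<Longrightarrow>
      (py has_real_derivative qy) (at s) \<Longrightarrow> (pv has_real_derivative qv) (at s) \<Longrightarrow>
      (pw has_real_derivative qw) (at s) \<Longrightarrow> (pz has_real_derivative qz) (at s) \<Longrightarrow>
      ((\<lambda>s. L (x, py s, pv s, pw s, pz s)) has_real_derivative
        dL_y L (x, py s, pv s, pw s, pz s) * qy + dL_v L (x, py s, pv s, pw s, pz s) * qv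
        + dL_w L (x, py s, pv s, pw s, pz s) * qw + dL_z L (x, py s, pv s, pw s, pz s) * qz) (at s)"
proof -
  let ?S = "{a..b} \<times> (UNIV :: (real \<times> real \<times> real \<times> real) set)"
  obtain f' where f': "\<And>p. p \<in> ?S \<Longrightarrow> (L has_derivative blinfun_apply (f' p)) (at p within ?S)"
    and c: "continuous_on ?S f'" using L unfolding C1_on_def by blast
  show "continuous_on ?S L" using f' has_derivative_continuous continuous_on_eq_continuous_within by blast
  have d: "dL_y L p = blinfun_apply (f' p) (0, 1, 0, 0, 0)" "dL_v L p = blinfun_apply (f' p) (0, 0, 1, 0, 0)"
    "dL_w L p = blinfun_apply (f' p) (0, 0, 0, 1, 0)" "dL_z L p = blinfun_apply (f' p) (0, 0, 0, 0, 1)"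
    if "p \<in> ?S" for p
  proof -
    obtain x y v w z where p: "p = (x, y, v, w, z)" by (metis prod_cases5)
    have x: "x \<in> {a..b}" using that p by auto
    note D = has_real_derivative_along_fibre[OF f' x]
    note vd = has_vector_derivative_Pair has_vector_derivative_id has_vector_derivative_const
    show "dL_y L p = blinfun_apply (f' p) (0, 1, 0, 0, 0)"
      unfolding p dL_y_def
      by (simp, rule DERIV_imp_deriv, rule D[of "\<lambda>s. (s, v, w, z)" "(1, 0, 0, 0)" y]) (assumption, intro vd)
    show "dL_v L p = blinfun_apply (f' p) (0, 0, 1, 0, 0)"
      unfolding p dL_v_def
      by (simp, rule DERIV_imp_deriv, rule D[of "\<lambda>s. (y, s, w, z)" "(0, 1, 0, 0)" v]) (assumption, intro vd)
    show "dL_w L p = blinfun_apply (f' p) (0, 0, 0, 1, 0)"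
      unfolding p dL_w_def
      by (simp, rule DERIV_imp_deriv, rule D[of "\<lambda>s. (y, v, s, z)" "(0, 0, 1, 0)" w]) (assumption, intro vd)
    show "dL_z L p = blinfun_apply (f' p) (0, 0, 0, 0, 1)"
      unfolding p dL_z_def
      by (simp, rule DERIV_imp_deriv, rule D[of "\<lambda>s. (y, v, w, s)" "(0, 0, 0, 1)" z]) (assumption, intro vd)
  qed
  show "continuous_on ?S (dL_y L)" "continuous_on ?S (dL_v L)" "continuous_on ?S (dL_w L)" "continuous_on ?S (dL_z L)"
    by (rule continuous_on_eq[OF continuous_on_blinfun_apply_const[OF c]], rule d[symmetric], assumption)+
  fix x py pv pw pz qy qv qw qz s
  assume x: "x \<in> {a..b}"
    and q: "(py has_real_derivative qy) (at s)" "(pv has_real_derivative qv) (at s)"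
      "(pw has_real_derivative qw) (at s)" "(pz has_real_derivative qz) (at s)"
  have vd: "((\<lambda>s. (py s, pv s, pw s, pz s)) has_vector_derivative (qy, qv, qw, qz)) (at s)"
    using q unfolding has_real_derivative_iff_has_vector_derivative
    by (intro has_vector_derivative_Pair)
  let ?p = "(x, py s, pv s, pw s, pz s)"
  have "(0, qy, qv, qw, qz) = qy *\<^sub>R (0, 1, 0, 0, 0) + qv *\<^sub>R (0, 0, 1, 0, 0)
      + qw *\<^sub>R (0, 0, 0, 1, 0) + qz *\<^sub>R (0::real, 0::real, 0::real, 0::real, 1::real)" by simp
  then have e: "blinfun_apply (f' ?p) (0, qy, qv, qw, qz) = dL_y L ?p * qy + dL_v L ?p * qv + dL_w L ?p * qw + dL_z L ?p * qz"
    using x by (simp only: blinfun.add_right blinfun.scaleR_right) (simp add: d)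
  show "((\<lambda>s. L (x, py s, pv s, pw s, pz s)) has_real_derivative
      dL_y L ?p * qy + dL_v L ?p * qv + dL_w L ?p * qw + dL_z L ?p * qz) (at s)"
    using has_real_derivative_along_fibre[OF f' x vd] unfolding e by simp
qed

lemma C1_on_lag4:
  assumes l: "C1_on ({a..b} \<times> UNIV) l"
  shows "continuous_on ({a..b} \<times> UNIV) l"
    "continuous_on ({a..b} \<times> UNIV) (dl_y l)" "continuous_on ({a..b} \<times> UNIV) (dl_v l)"
    "continuous_on ({a..b} \<times> UNIV) (dl_w l)"
    "\<And>x py pv pw qy qv qw s. x \<in> {a..b} \<Longrightarrow>
      (py has_real_derivative qy) (at s) \<Longrightarrow> (pv has_real_derivative qv) (at s) \<Longrightarrow>
      (pw has_real_derivative qw) (at s) \<Longrightarrow>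
      ((\<lambda>s. l (x, py s, pv s, pw s)) has_real_derivative
        dl_y l (x, py s, pv s, pw s) * qy + dl_v l (x, py s, pv s, pw s) * qv
        + dl_w l (x, py s, pv s, pw s) * qw) (at s)"
proof -
  let ?S = "{a..b} \<times> (UNIV :: (real \<times> real \<times> real) set)"
  obtain f' where f': "\<And>p. p \<in> ?S \<Longrightarrow> (l has_derivative blinfun_apply (f' p)) (at p within ?S)"
    and c: "continuous_on ?S f'" using l unfolding C1_on_def by blast
  show "continuous_on ?S l" using f' has_derivative_continuous continuous_on_eq_continuous_within by blast
  have d: "dl_y l p = blinfun_apply (f' p) (0, 1, 0, 0)" "dl_v l p = blinfun_apply (f' p) (0, 0, 1, 0)"
    "dl_w l p = blinfun_apply (f' p) (0, 0, 0, 1)"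
    if "p \<in> ?S" for p
  proof -
    obtain x y v w where p: "p = (x, y, v, w)" by (metis prod_cases4)
    have x: "x \<in> {a..b}" using that p by auto
    note D = has_real_derivative_along_fibre[OF f' x]
    note vd = has_vector_derivative_Pair has_vector_derivative_id has_vector_derivative_const
    show "dl_y l p = blinfun_apply (f' p) (0, 1, 0, 0)"
      unfolding p dl_y_def
      by (simp, rule DERIV_imp_deriv, rule D[of "\<lambda>s. (s, v, w)" "(1, 0, 0)" y]) (assumption, intro vd)
    show "dl_v l p = blinfun_apply (f' p) (0, 0, 1, 0)"
      unfolding p dl_v_def
      by (simp, rule DERIV_imp_deriv, rule D[of "\<lambda>s. (y, s, w)" "(0, 1, 0)" v]) (assumption, intro vd)
    show "dl_w l p = blinfun_apply (f' p) (0, 0, 0, 1)"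
      unfolding p dl_w_def
      by (simp, rule DERIV_imp_deriv, rule D[of "\<lambda>s. (y, v, s)" "(0, 0, 1)" w]) (assumption, intro vd)
  qed
  show "continuous_on ?S (dl_y l)" "continuous_on ?S (dl_v l)" "continuous_on ?S (dl_w l)"
    by (rule continuous_on_eq[OF continuous_on_blinfun_apply_const[OF c]], rule d[symmetric], assumption)+
  fix x py pv pw qy qv qw s
  assume x: "x \<in> {a..b}"
    and q: "(py has_real_derivative qy) (at s)" "(pv has_real_derivative qv) (at s)"
      "(pw has_real_derivative qw) (at s)"
  have vd: "((\<lambda>s. (py s, pv s, pw s)) has_vector_derivative (qy, qv, qw)) (at s)"
    using q unfolding has_real_derivative_iff_has_vector_derivative
    by (intro has_vector_derivative_Pair)
  let ?p = "(x, py s, pv s, pw s)"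
  have "(0, qy, qv, qw) = qy *\<^sub>R (0, 1, 0, 0) + qv *\<^sub>R (0, 0, 1, 0)
      + qw *\<^sub>R (0::real, 0::real, 0::real, 1::real)" by simp
  then have e: "blinfun_apply (f' ?p) (0, qy, qv, qw) = dl_y l ?p * qy + dl_v l ?p * qv + dl_w l ?p * qw"
    using x by (simp only: blinfun.add_right blinfun.scaleR_right) (simp add: d)
  show "((\<lambda>s. l (x, py s, pv s, pw s)) has_real_derivative
      dl_y l ?p * qy + dl_v l ?p * qv + dl_w l ?p * qw) (at s)"
    using has_real_derivative_along_fibre[OF f' x vd] unfolding e by simp
qed

section \<open>Integrals with a parameter and a variable upper limit\<close>

lemma integral_scaled:
  fixes f :: "real \<Rightarrow> real"
  assumes f: "continuous_on {a..x} f" and x: "a \<le> x"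
  shows "integral {a..x} f = (x - a) * integral {0..1} (\<lambda>s. f (a + s * (x - a)))"
proof (cases "x = a")
  case False
  define m where "m = x - a"
  have m: "m > 0" "m \<noteq> 0" using False x by (auto simp: m_def)
  have "(f has_integral integral {a..x} f) (cbox a x)" using f
    by (simp add: integrable_continuous_real integrable_integral)
  from has_integral_affinity[OF this m(2), of a]
  have 1: "((\<lambda>s. f (m * s + a)) has_integral (1 / m) * integral {a..x} f)
     ((\<lambda>t. (1 / m) * t + - ((1 / m) * a)) ` {a..x})" using m by simp
  have img: "(\<lambda>t. (1 / m) * t + - ((1 / m) * a)) ` {a..x} = {0..1}"
    using m x image_affinity_atLeastAtMost[of "1 / m" "- ((1 / m) * a)" a x]
    by (simp add: m_def diff_divide_distrib[symmetric])
  have "(1 / m) * integral {a..x} f = integral {0..1} (\<lambda>s. f (m * s + a))"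
    using 1 unfolding img by (simp add: integral_unique)
  then show ?thesis using m by (simp add: field_simps m_def[symmetric])
qed simp

text \<open>Joint continuity is needed while both the parameter and the domain vary; scaling to
  [0, 1] moves the upper limit into the integrand.\<close>

lemma continuous_on_indefinite_integral_param:
  fixes h :: "real \<Rightarrow> real \<Rightarrow> real"
  assumes h: "continuous_on (UNIV \<times> {a..b}) (\<lambda>(e, t). h e t)"
  shows "continuous_on (UNIV \<times> {a..b}) (\<lambda>(e, x). integral {a..x} (h e))"
proof -
  have seg: "a + s * (x - a) \<in> {a..b}" if "x \<in> {a..b}" "s \<in> {0..1}" for x s :: real
  proof -
    have "0 \<le> s * (x - a)" "s * (x - a) \<le> 1 * (x - a)" using that by (intro mult_nonneg_nonneg mult_right_mono; simp)+
    then show ?thesis using that by simp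
  qed
  have "continuous_on (((UNIV :: real set) \<times> {a..b}) \<times> cbox 0 (1 :: real)) (\<lambda>(p, s). h (fst p) (a + s * (snd p - a)))"
  proof -
    have "continuous_on (((UNIV :: real set) \<times> {a..b}) \<times> cbox 0 (1 :: real)) (\<lambda>q. (\<lambda>(e, t). h e t) (fst (fst q), a + snd q * (snd (fst q) - a)))"
      using seg by (intro continuous_on_compose2[OF h] continuous_intros) auto
    then show ?thesis by (simp add: case_prod_beta)
  qed
  from integral_continuous_on_param[OF this]
  have "continuous_on (UNIV \<times> {a..b}) (\<lambda>p. (snd p - a) * integral {0..1} (\<lambda>s. h (fst p) (a + s * (snd p - a))))"
    by (intro continuous_intros) simp
  then show ?thesis
  proof (rule continuous_on_eq)
    fix p :: "real \<times> real" assume p: "p \<in> UNIV \<times> {a..b}"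
    have "continuous_on {a..snd p} (\<lambda>t. (\<lambda>(e, t). h e t) (fst p, t))"
      using p by (intro continuous_on_compose2[OF h] continuous_intros) auto
    then show "(snd p - a) * integral {0..1} (\<lambda>s. h (fst p) (a + s * (snd p - a))) = (\<lambda>(e, x). integral {a..x} (h e)) p"
      using integral_scaled[of a "snd p" "h (fst p)"] p by (auto simp: case_prod_beta)
  qed
qed

text \<open>Two nested applications of the Leibniz rule, first to \<open>z\<close> and then to the
  outer integral. The fractional operators are abstracted away: all that matters is that
  \<open>y\<close>, \<open>v\<close> and \<open>w\<close> move affinely in \<open>e\<close> along
  continuous directions.\<close>

lemma first_variation:
  fixes y v w \<eta> V W :: "real \<Rightarrow> real"
  assumes L: "C1_on ({a..b} \<times> UNIV) L" and l: "C1_on ({a..b} \<times> UNIV) l"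
    and c: "continuous_on {a..b} y" "continuous_on {a..b} v" "continuous_on {a..b} w"
      "continuous_on {a..b} \<eta>" "continuous_on {a..b} V" "continuous_on {a..b} W"
  defines "cu \<equiv> \<lambda>e t. (t, y t + e * \<eta> t, v t + e * V t, w t + e * W t)"
  defines "z \<equiv> \<lambda>e x. integral {a..x} (\<lambda>t. l (cu e t))"
  defines "sq \<equiv> \<lambda>e t. (t, y t + e * \<eta> t, v t + e * V t, w t + e * W t, z e t)"
  shows "((\<lambda>e. integral {a..b} (\<lambda>x. L (sq e x))) has_real_derivative
    integral {a..b} (\<lambda>x. dL_y L (sq 0 x) * \<eta> x + dL_v L (sq 0 x) * V x + dL_w L (sq 0 x) * W x
      + dL_z L (sq 0 x) * integral {a..x} (\<lambda>t. dl_y l (cu 0 t) * \<eta> t + dl_v l (cu 0 t) * V t + dl_w l (cu 0 t) * W t)))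
    (at 0)"
proof -
  note l' = C1_on_lag4[OF l] and L' = C1_on_lag5[OF L]
  define T where "T = (UNIV :: real set) \<times> {a..b}"
  have snd_c: "continuous_on T (\<lambda>p. k (snd p))" if "continuous_on {a..b} k" for k :: "real \<Rightarrow> real"
    unfolding T_def by (intro continuous_on_compose2[OF that] continuous_intros) auto
  note [continuous_intros] = c[THEN snd_c]
  have cuc: "continuous_on T (\<lambda>p. cu (fst p) (snd p))"
    unfolding cu_def by (intro continuous_intros)
  have comp_cu: "continuous_on T (\<lambda>p. k (cu (fst p) (snd p)))" if "continuous_on ({a..b} \<times> UNIV) k" for k :: lag4
    by (rule continuous_on_compose2[OF that cuc]) (auto simp: T_def cu_def)
  define m where "m e t = dl_y l (cu e t) * \<eta> t + dl_v l (cu e t) * V t + dl_w l (cu e t) * W t" for e t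
  have mc: "continuous_on T (\<lambda>(e, t). m e t)"
    unfolding m_def case_prod_beta by (intro continuous_intros comp_cu l')
  have zc: "continuous_on T (\<lambda>(e, x). z e x)"
    unfolding z_def T_def
    by (rule continuous_on_indefinite_integral_param) (use comp_cu[OF l'(1)] in \<open>simp add: T_def case_prod_beta\<close>)
  have slice: "continuous_on {a..b} (k e)" if "continuous_on T (\<lambda>(e, t). k e t)" for k :: "real \<Rightarrow> real \<Rightarrow> real" and e
  proof -
    have "continuous_on {a..b} (\<lambda>t. (\<lambda>(e, t). k e t) (e, t))"
      unfolding T_def by (intro continuous_on_compose2[OF that] continuous_intros) (auto simp: T_def)
    then show ?thesis by simp
  qed
  \<comment> \<open>This is needed for every \<open>e\<close> and not just at 0, because the outer
    Leibniz rule asks for a derivative that is jointly continuous in \<open>e\<close> and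
    \<open>x\<close>.\<close>
  have zd: "((\<lambda>e. z e x) has_real_derivative integral {a..x} (m e)) (at e)" if x: "x \<in> {a..b}" for x e
  proof -
    have "((\<lambda>e. integral (cbox a x) (\<lambda>t. l (cu e t))) has_real_derivative integral (cbox a x) (m e)) (at e within UNIV)"
    proof (rule leibniz_rule_field_derivative)
      fix e t assume "t \<in> cbox a x"
      then have t: "t \<in> {a..b}" using x by auto
      show "((\<lambda>e. l (cu e t)) has_real_derivative m e t) (at e)"
        unfolding cu_def m_def by (rule l'(5)[OF t]) (auto intro!: derivative_eq_intros)
    next
      fix e
      have "continuous_on {a..b} (\<lambda>t. l (cu e t))"
        using slice[of "\<lambda>e t. l (cu e t)"] comp_cu[OF l'(1)] by (simp add: case_prod_beta)
      then show "(\<lambda>t. l (cu e t)) integrable_on cbox a x"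
        using x by (auto intro!: integrable_continuous_real intro: continuous_on_subset)
    next
      show "continuous_on (UNIV \<times> cbox a x) (\<lambda>(e, t). m e t)"
        using x by (intro continuous_on_subset[OF mc]) (auto simp: T_def)
    qed auto
    then show ?thesis by (simp add: z_def)
  qed
  define M where "M e x = integral {a..x} (m e)" for e x
  have Mc: "continuous_on T (\<lambda>(e, x). M e x)"
    unfolding M_def T_def by (rule continuous_on_indefinite_integral_param) (use mc in \<open>simp add: T_def\<close>)
  have sqc: "continuous_on T (\<lambda>p. sq (fst p) (snd p))"
    unfolding sq_def using zc by (intro continuous_intros) (simp add: case_prod_beta)
  have comp_sq: "continuous_on T (\<lambda>p. k (sq (fst p) (snd p)))" if "continuous_on ({a..b} \<times> UNIV) k" for k :: lag5
    by (rule continuous_on_compose2[OF that sqc]) (auto simp: T_def sq_def)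
  define D where "D e x = dL_y L (sq e x) * \<eta> x + dL_v L (sq e x) * V x + dL_w L (sq e x) * W x + dL_z L (sq e x) * M e x" for e x
  have "((\<lambda>e. integral (cbox a b) (\<lambda>x. L (sq e x))) has_real_derivative integral (cbox a b) (D 0)) (at 0 within UNIV)"
  proof (rule leibniz_rule_field_derivative)
    fix e x assume "x \<in> cbox a b"
    then have x: "x \<in> {a..b}" by auto
    show "((\<lambda>e. L (sq e x)) has_real_derivative D e x) (at e)"
      unfolding sq_def D_def M_def
      by (rule L'(6)[OF x]) (auto intro!: derivative_eq_intros zd[OF x])
  next
    fix e
    have "continuous_on {a..b} (\<lambda>t. L (sq e t))"
      using slice[of "\<lambda>e t. L (sq e t)"] comp_sq[OF L'(1)] by (simp add: case_prod_beta)
    then show "(\<lambda>t. L (sq e t)) integrable_on cbox a b"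
      by (auto intro!: integrable_continuous_real)
  next
    show "continuous_on (UNIV \<times> cbox a b) (\<lambda>(e, t). D e t)"
      using Mc comp_sq[OF L'(2)] comp_sq[OF L'(3)] comp_sq[OF L'(4)] comp_sq[OF L'(5)]
      unfolding D_def case_prod_beta by (auto simp flip: T_def intro!: continuous_intros)
  qed auto
  then show ?thesis by (simp add: D_def[abs_def] M_def m_def[abs_def])
qed

section \<open>Admissible variations and the du Bois-Reymond lemma\<close>

text \<open>Integrability is assumed rather than continuity, since the intended \<open>f\<close>
  includes \<open>deriv y\<close>.\<close>

lemma rl_left_integral_add_scaled:
  fixes f g :: "real \<Rightarrow> real"
  assumes "(\<lambda>t. (x - t) powr (\<gamma> - 1) * f t) absolutely_integrable_on {a..x}"
    and "(\<lambda>t. (x - t) powr (\<gamma> - 1) * g t) absolutely_integrable_on {a..x}"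
  shows "(\<lambda>t. (x - t) powr (\<gamma> - 1) * (f t + e * g t)) absolutely_integrable_on {a..x}"
    "rl_left_integral a \<gamma> (\<lambda>t. f t + e * g t) x = rl_left_integral a \<gamma> f x + e * rl_left_integral a \<gamma> g x"
proof -
  have eq: "(\<lambda>t. (x - t) powr (\<gamma> - 1) * (f t + e * g t)) =
    (\<lambda>t. (x - t) powr (\<gamma> - 1) * f t + e * ((x - t) powr (\<gamma> - 1) * g t))"
    by (simp add: algebra_simps)
  show "(\<lambda>t. (x - t) powr (\<gamma> - 1) * (f t + e * g t)) absolutely_integrable_on {a..x}"
    unfolding eq by (intro set_integral_add(1) set_integrable_mult_right assms)
  have "integral {a..x} (\<lambda>t. (x - t) powr (\<gamma> - 1) * (f t + e * g t)) =
    integral {a..x} (\<lambda>t. (x - t) powr (\<gamma> - 1) * f t) + e * integral {a..x} (\<lambda>t. (x - t) powr (\<gamma> - 1) * g t)"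
    unfolding eq using assms[THEN set_lebesgue_integral_eq_integral(1)]
    by (subst Henstock_Kurzweil_Integration.integral_add) (auto intro: integrable_on_mult_right)
  then show "rl_left_integral a \<gamma> (\<lambda>t. f t + e * g t) x = rl_left_integral a \<gamma> f x + e * rl_left_integral a \<gamma> g x"
    by (simp add: rl_left_integral_def algebra_simps)
qed

lemma indefinite_integral_lipschitz:
  fixes h :: "real \<Rightarrow> real"
  assumes h: "continuous_on {a..b} h"
  shows "\<exists>C. C-lipschitz_on {a..b} (\<lambda>x. integral {a..x} h)"
proof -
  obtain M where M: "M \<ge> 0" "\<And>x. x \<in> {a..b} \<Longrightarrow> \<bar>h x\<bar> \<le> M"
    using continuous_on_imp_abs_bound[OF h] by blast
  have "M-lipschitz_on {a..b} (\<lambda>x. integral {a..x} h)"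
  proof (rule lipschitz_onI)
    fix x y assume "x \<in> {a..b}" "y \<in> {a..b}"
    then show "dist (integral {a..x} h) (integral {a..y} h) \<le> M * dist x y"
      using field_differentiable_bound[of "{a..b}" "\<lambda>x. integral {a..x} h" h M x y]
        integral_has_real_derivative[OF h] M
      by (simp add: dist_norm)
  qed (rule M)
  then show ?thesis by blast
qed

lemma frac_class_variation:
  fixes h y :: "real \<Rightarrow> real" and e :: real
  assumes ab: "a < b" and \<alpha>: "0 < \<alpha>" "\<alpha> < 1" and \<beta>: "0 < \<beta>"
    and y: "y \<in> frac_class a b \<alpha> \<beta>" and h: "continuous_on {a..b} h"
  defines "\<eta> \<equiv> \<lambda>x. integral {a..x} h"
  defines "u \<equiv> \<lambda>x. y x + e * \<eta> x"
  shows "u \<in> frac_class a b \<alpha> \<beta>"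
    "\<And>x. x \<in> {a..b} \<Longrightarrow> caputo_left a \<alpha> u x = caputo_left a \<alpha> y x + e * rl_left_integral a (1 - \<alpha>) h x"
    "\<And>x. x \<in> {a..b} \<Longrightarrow> rl_left_integral a \<beta> u x = rl_left_integral a \<beta> y x + e * rl_left_integral a \<beta> \<eta> x"
proof -
  have yac: "abs_continuous_on a b y"
    and yc: "\<And>x. x \<in> {a..b} \<Longrightarrow> (\<lambda>t. (x - t) powr (- \<alpha>) * deriv y t) absolutely_integrable_on {a..x}"
    and yv: "continuous_on {a..b} (caputo_left a \<alpha> y)"
    and yi: "\<And>x. x \<in> {a..b} \<Longrightarrow> (\<lambda>t. (x - t) powr (\<beta> - 1) * y t) absolutely_integrable_on {a..x}"
    and yw: "continuous_on {a..b} (rl_left_integral a \<beta> y)"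
    using y by (auto simp: frac_class_def)
  have \<eta>d: "(\<eta> has_real_derivative h t) (at t within {a..b})" if "t \<in> {a..b}" for t
    unfolding \<eta>_def by (rule integral_has_real_derivative[OF h that])
  then have \<eta>c: "continuous_on {a..b} \<eta>"
    by (meson DERIV_continuous continuous_on_eq_continuous_within)
  obtain C where C: "C-lipschitz_on {a..b} \<eta>" unfolding \<eta>_def using indefinite_integral_lipschitz[OF h] by blast
  have uac: "abs_continuous_on a b u" unfolding u_def
    by (intro abs_continuous_on_add yac lipschitz_on_imp_abs_continuous_on[OF lipschitz_on_cmult_real[OF C]])
  \<comment> \<open>The endpoints are thrown in because \<open>deriv\<close> is two-sided, while
    \<eta> is controlled only relative to [a, b].\<close>
  define N where "N = {t\<in>{a..b}. \<not> y differentiable (at t)} \<union> {a, b}"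
  have N: "negligible N" unfolding N_def using abs_continuous_on_differentiable_ae[OF yac] ab
    by (intro negligible_Un) (auto simp: negligible_finite)
  have ud: "deriv u t = deriv y t + e * h t" if t: "t \<in> {a..b} - N" for t
  proof -
    have ti: "t \<in> {a<..<b}" "y differentiable (at t)" using t by (auto simp: N_def)
    then have "(y has_real_derivative deriv y t) (at t)"
      using DERIV_deriv_iff_real_differentiable by blast
    moreover have "(\<eta> has_real_derivative h t) (at t)" using \<eta>d[of t] ti
      by (metis at_within_Icc_at greaterThanLessThan_iff greaterThanLessThan_subseteq_atLeastAtMost_iff order_refl subsetD)
    ultimately have "(u has_real_derivative deriv y t + e * h t) (at t)"
      unfolding u_def by (auto intro!: derivative_eq_intros)
    then show ?thesis by (rule DERIV_imp_deriv)
  qed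
  have hi: "(\<lambda>t. (x - t) powr (1 - \<alpha> - 1) * h t) absolutely_integrable_on {a..x}" if "x \<in> {a..b}" for x
    using \<alpha> that by (intro rl_left_absolutely_integrable continuous_on_subset[OF h]) auto
  have \<eta>i: "(\<lambda>t. (x - t) powr (\<beta> - 1) * \<eta> t) absolutely_integrable_on {a..x}" if "x \<in> {a..b}" for x
    using \<beta> that by (intro rl_left_absolutely_integrable continuous_on_subset[OF \<eta>c]) auto
  have cap: "caputo_left a \<alpha> k = rl_left_integral a (1 - \<alpha>) (deriv k)" for k
    by (simp add: caputo_left_def rl_left_integral_def fun_eq_iff)
  have uc: "(\<lambda>t. (x - t) powr (- \<alpha>) * deriv u t) absolutely_integrable_on {a..x}"
    "caputo_left a \<alpha> u x = caputo_left a \<alpha> y x + e * rl_left_integral a (1 - \<alpha>) h x"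
    if x: "x \<in> {a..b}" for x
  proof -
    let ?g = "\<lambda>t. (x - t) powr (1 - \<alpha> - 1) * (deriv y t + e * h t)"
    have yc': "(\<lambda>t. (x - t) powr (1 - \<alpha> - 1) * deriv y t) absolutely_integrable_on {a..x}" using yc[OF x] by simp
    note S = rl_left_integral_add_scaled[OF yc' hi[OF x], of e]
    have eq: "(x - t) powr (- \<alpha>) * deriv u t = ?g t" if "t \<in> {a..x} - N" for t
      using ud[of t] that x by simp
    show "(\<lambda>t. (x - t) powr (- \<alpha>) * deriv u t) absolutely_integrable_on {a..x}"
      by (rule absolutely_integrable_spike[OF S(1) N eq])
    have "integral {a..x} (\<lambda>t. (x - t) powr (- \<alpha>) * deriv u t) = integral {a..x} ?g"
      by (rule integral_spike[OF N eq[symmetric]])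
    then have "caputo_left a \<alpha> u x = rl_left_integral a (1 - \<alpha>) (\<lambda>t. deriv y t + e * h t) x"
      by (simp add: caputo_left_def rl_left_integral_def)
    then show "caputo_left a \<alpha> u x = caputo_left a \<alpha> y x + e * rl_left_integral a (1 - \<alpha>) h x"
      using S(2) by (simp add: cap)
  qed
  show "\<And>x. x \<in> {a..b} \<Longrightarrow> caputo_left a \<alpha> u x = caputo_left a \<alpha> y x + e * rl_left_integral a (1 - \<alpha>) h x" by (rule uc)
  note ui = rl_left_integral_add_scaled[OF yi \<eta>i, of _ e]
  show ui2: "\<And>x. x \<in> {a..b} \<Longrightarrow> rl_left_integral a \<beta> u x = rl_left_integral a \<beta> y x + e * rl_left_integral a \<beta> \<eta> x"
    unfolding u_def by (rule ui)
  have "continuous_on {a..b} (\<lambda>x. caputo_left a \<alpha> y x + e * rl_left_integral a (1 - \<alpha>) h x)"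
    using \<alpha> by (intro continuous_on_add continuous_on_mult continuous_on_const yv continuous_on_rl_left_integral h) auto
  then have 1: "continuous_on {a..b} (caputo_left a \<alpha> u)" by (rule continuous_on_eq) (simp add: uc(2))
  have "continuous_on {a..b} (\<lambda>x. rl_left_integral a \<beta> y x + e * rl_left_integral a \<beta> \<eta> x)"
    by (intro continuous_on_add continuous_on_mult continuous_on_const yw continuous_on_rl_left_integral \<eta>c \<beta>)
  then have 2: "continuous_on {a..b} (rl_left_integral a \<beta> u)" by (rule continuous_on_eq) (simp add: ui2)
  have "(\<lambda>t. (x - t) powr (\<beta> - 1) * u t) absolutely_integrable_on {a..x}" if "x \<in> {a..b}" for x
    unfolding u_def by (rule ui(1)[OF that that])
  then show "u \<in> frac_class a b \<alpha> \<beta>"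
    unfolding frac_class_def using uac uc(1) 1 2 by blast
qed

text \<open>With \<Psi> a primitive of \<psi>, integration by parts turns the hypothesis into
  orthogonality of \<open>K - \<Psi>\<close> to every continuous \<open>h\<close> of mean zero.
  Testing with \<open>K - \<Psi>\<close> minus its own mean shows that this difference is
  constant.\<close>

lemma du_Bois_Reymond:
  fixes \<psi> K :: "real \<Rightarrow> real"
  assumes ab: "a < b" and \<psi>: "continuous_on {a..b} \<psi>" and K: "continuous_on {a..b} K"
    and var: "\<And>h. continuous_on {a..b} h \<Longrightarrow> integral {a..b} h = 0 \<Longrightarrow>
      integral {a..b} (\<lambda>x. \<psi> x * integral {a..x} h + K x * h x) = 0"
    and x: "x \<in> {a..b}"
  shows "(K has_real_derivative \<psi> x) (at x within {a..b})"
proof -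
  define \<Psi> where "\<Psi> x = integral {a..x} \<psi>" for x
  define D where "D x = K x - \<Psi> x" for x
  define c where "c = integral {a..b} D / (b - a)"
  define h where "h x = D x - c" for x
  define \<eta> where "\<eta> x = integral {a..x} h" for x
  have \<Psi>d: "(\<Psi> has_real_derivative \<psi> t) (at t within {a..b})" if "t \<in> {a..b}" for t
    unfolding \<Psi>_def by (rule integral_has_real_derivative[OF \<psi> that])
  then have \<Psi>: "continuous_on {a..b} \<Psi>"
    by (meson DERIV_continuous continuous_on_eq_continuous_within)
  have D: "continuous_on {a..b} D" unfolding D_def by (intro continuous_intros K \<Psi>)
  have h: "continuous_on {a..b} h" unfolding h_def by (intro continuous_intros D)
  have \<eta>d: "(\<eta> has_real_derivative h t) (at t within {a..b})" if "t \<in> {a..b}" for t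
    unfolding \<eta>_def by (rule integral_has_real_derivative[OF h that])
  then have \<eta>: "continuous_on {a..b} \<eta>"
    by (meson DERIV_continuous continuous_on_eq_continuous_within)
  have "integral {a..b} h = integral {a..b} D - c * (b - a)" unfolding h_def
    using D ab by (subst Henstock_Kurzweil_Integration.integral_diff) (auto intro: integrable_continuous_real)
  then have h0: "integral {a..b} h = 0" using ab by (simp add: c_def)
  \<comment> \<open>The boundary terms vanish: \<eta> is 0 at \<open>a\<close> by definition and at
    \<open>b\<close> because \<open>h\<close> has mean zero.\<close>
  have "((\<lambda>t. \<psi> t * \<eta> t + \<Psi> t * h t) has_integral (\<Psi> b * \<eta> b - \<Psi> a * \<eta> a)) {a..b}"
  proof (rule fundamental_theorem_of_calculus)
    fix t assume "t \<in> {a..b}"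
    then have "((\<lambda>t. \<Psi> t * \<eta> t) has_real_derivative \<psi> t * \<eta> t + \<Psi> t * h t) (at t within {a..b})"
      by (auto intro!: derivative_eq_intros \<Psi>d \<eta>d)
    then show "((\<lambda>t. \<Psi> t * \<eta> t) has_vector_derivative \<psi> t * \<eta> t + \<Psi> t * h t) (at t within {a..b})"
      by (simp add: has_real_derivative_iff_has_vector_derivative)
  qed (use ab in simp)
  then have 1: "((\<lambda>t. \<psi> t * \<eta> t + \<Psi> t * h t) has_integral 0) {a..b}"
    using h0 by (simp add: \<Psi>_def \<eta>_def)
  have "continuous_on {a..b} (\<lambda>t. \<psi> t * \<eta> t + K t * h t)" by (intro continuous_intros \<psi> \<eta> K h)
  from integrable_integral[OF integrable_continuous_real[OF this]]
  have 2: "((\<lambda>t. \<psi> t * \<eta> t + K t * h t) has_integral 0) {a..b}"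
    using var[OF h h0] by (simp add: \<eta>_def)
  have 3: "((\<lambda>t. c * h t) has_integral 0) {a..b}"
    using has_integral_mult_right[OF integrable_integral[OF integrable_continuous_real[OF h]], of c] h0 by simp
  \<comment> \<open>Since \<open>h = K - \<Psi> - c\<close>, the three vanishing integrals combine
    to that of the square of \<open>h\<close>.\<close>
  have eq: "\<psi> t * \<eta> t + K t * h t - (\<psi> t * \<eta> t + \<Psi> t * h t) - c * h t = h t * h t" for t
    by (simp add: h_def D_def algebra_simps)
  have "((\<lambda>t. h t * h t) has_integral 0) (cbox a b)"
    using has_integral_diff[OF has_integral_diff[OF 2 1] 3] unfolding eq by simp
  then have "h t * h t = 0" if "t \<in> {a..b}" for t
    by (rule has_integral_0_cbox_imp_0[rotated 2]) (use that ab h in \<open>auto intro!: continuous_intros\<close>)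
  then have "K t = c + \<Psi> t" if "t \<in> {a..b}" for t using that unfolding h_def D_def by fastforce
  moreover have "((\<lambda>t. c + \<Psi> t) has_real_derivative \<psi> x) (at x within {a..b})"
    using \<Psi>d[OF x] by (auto intro!: derivative_eq_intros)
  ultimately show ?thesis using x
    by (auto intro: has_field_derivative_transform_within[of _ _ _ _ 1])
qed

section \<open>Integrals of order one, and the right derivative as derivative of an integral\<close>

lemma rl_left_integral_1:
  fixes f :: "real \<Rightarrow> real"
  shows "rl_left_integral a 1 f x = integral {a..x} f"
proof -
  \<comment> \<open>\<open>0 powr 0\<close> is 0, so the kernel differs from 1 at
    \<open>t = x\<close>.\<close>
  have "integral {a..x} (\<lambda>t. (x - t) powr 0 * f t) = integral {a..x} f"
    by (rule integral_spike[of "{x}"]) auto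
  then show ?thesis by (simp add: rl_left_integral_def)
qed

lemma rl_right_integral_1:
  fixes f :: "real \<Rightarrow> real"
  shows "rl_right_integral b 1 f x = integral {x..b} f"
proof -
  have "integral {x..b} (\<lambda>t. (t - x) powr 0 * f t) = integral {x..b} f"
    by (rule integral_spike[of "{x}"]) auto
  then show ?thesis by (simp add: rl_right_integral_def)
qed

lemma rl_right_integral_add:
  fixes f g :: "real \<Rightarrow> real"
  assumes "\<gamma> > 0" "continuous_on {x..b} f" "continuous_on {x..b} g"
  shows "rl_right_integral b \<gamma> (\<lambda>t. f t + g t) x = rl_right_integral b \<gamma> f x + rl_right_integral b \<gamma> g x"
proof -
  have i: "(\<lambda>t. (t - x) powr (\<gamma> - 1) * k t) integrable_on {x..b}" if "continuous_on {x..b} k" for k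
    by (rule set_lebesgue_integral_eq_integral(1)[OF rl_right_absolutely_integrable[OF assms(1) that]])
  show ?thesis
    unfolding rl_right_integral_def distrib_left
      Henstock_Kurzweil_Integration.integral_add[OF i[OF assms(2)] i[OF assms(3)]] by (rule refl)
qed

text \<open>For continuous \<open>f\<close> the integrability clause is automatic and the Gamma
  factor cancels, so everything reduces to ordinary differentiability of the right integral of order
  \<open>1 - \<alpha>\<close>. Uniqueness of the one-sided derivative at an endpoint rests on
  \<open>a < b\<close>.\<close>

lemma rl_right_deriv_eq:
  fixes f :: "real \<Rightarrow> real"
  assumes ab: "a < b" and \<alpha>: "\<alpha> < 1" and f: "continuous_on {a..b} f" and x: "x \<in> {a..b}"
  shows rl_right_deriv_exists_iff:
    "rl_right_deriv_exists a b \<alpha> f x \<longleftrightarrow> (\<exists>d. (rl_right_integral b (1 - \<alpha>) f has_real_derivative d) (at x within {a..b}))"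
    and rl_right_deriv_eqI:
    "(rl_right_integral b (1 - \<alpha>) f has_real_derivative d) (at x within {a..b}) \<Longrightarrow> rl_right_deriv a b \<alpha> f x = - d"
proof -
  let ?G = "Gamma (1 - \<alpha>)" and ?I = "rl_right_integral b (1 - \<alpha>) f"
  have G: "?G > 0" using \<alpha> by (intro Gamma_real_pos) simp
  have I: "(\<lambda>s. integral {s..b} (\<lambda>t. (t - s) powr (- \<alpha>) * f t)) = (\<lambda>s. ?G * ?I s)"
    using G by (simp add: rl_right_integral_def fun_eq_iff)
  have ai: "\<forall>s\<in>{a..b}. (\<lambda>t. (t - s) powr (- \<alpha>) * f t) absolutely_integrable_on {s..b}"
  proof
    fix s assume "s \<in> {a..b}"
    then have "continuous_on {s..b} f" using f by (auto intro: continuous_on_subset)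
    from rl_right_absolutely_integrable[OF _ this, of "1 - \<alpha>"] \<alpha>
    show "(\<lambda>t. (t - s) powr (- \<alpha>) * f t) absolutely_integrable_on {s..b}" by simp
  qed
  have "(\<lambda>s. ?G * ?I s) differentiable (at x within {a..b}) \<longleftrightarrow> ?I differentiable (at x within {a..b})"
  proof
    assume "(\<lambda>s. ?G * ?I s) differentiable (at x within {a..b})"
    from differentiable_mult[OF differentiable_const this, of "1 / ?G"]
    have "(\<lambda>s. 1 / ?G * (?G * ?I s)) differentiable (at x within {a..b})" .
    moreover have "(\<lambda>s. 1 / ?G * (?G * ?I s)) = ?I" using less_imp_neq[OF G] by (auto simp: fun_eq_iff)
    ultimately show "?I differentiable (at x within {a..b})" by simp
  qed (intro differentiable_mult differentiable_const)
  then show "rl_right_deriv_exists a b \<alpha> f x \<longleftrightarrow> (\<exists>d. (?I has_real_derivative d) (at x within {a..b}))"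
    unfolding rl_right_deriv_exists_def I using ai by (simp add: real_differentiable_def)
  assume "(?I has_real_derivative d) (at x within {a..b})"
  then have "((\<lambda>s. ?G * ?I s) has_real_derivative ?G * d) (at x within {a..b})"
    by (rule DERIV_cmult)
  then have "vector_derivative (\<lambda>s. ?G * ?I s) (at x within {a..b}) = ?G * d"
    using ab x by (intro vector_derivative_within_closed_interval)
      (auto simp: has_real_derivative_iff_has_vector_derivative)
  then show "rl_right_deriv a b \<alpha> f x = - d"
    unfolding rl_right_deriv_def I using G by simp
qed

section \<open>The Euler-Lagrange equation\<close>

text \<open>Along \<open>y + e * \<eta>\<close> the Caputo derivative and the fractional integral
  are affine in \<open>e\<close> on [a, b], which is exactly the shape treated by
  \<open>first_variation\<close>.\<close>

lemma J_functional_variation: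
  fixes h y :: "real \<Rightarrow> real"
  assumes ab: "a < b" and \<alpha>: "0 < \<alpha>" "\<alpha> < 1" and \<beta>: "0 < \<beta>"
    and L: "C1_on ({a..b} \<times> UNIV) L" and l: "C1_on ({a..b} \<times> UNIV) l"
    and y: "y \<in> frac_class a b \<alpha> \<beta>" and h: "continuous_on {a..b} h"
  defines "\<eta> \<equiv> \<lambda>x. integral {a..x} h"
  defines "V \<equiv> rl_left_integral a (1 - \<alpha>) h" and "W \<equiv> rl_left_integral a \<beta> \<eta>"
  defines "sq \<equiv> square_args l a \<alpha> \<beta> y" and "cu \<equiv> curly_args a \<alpha> \<beta> y"
  shows "((\<lambda>e. J_functional L l a b \<alpha> \<beta> (\<lambda>x. y x + e * \<eta> x)) has_real_derivative
    integral {a..b} (\<lambda>x. dL_y L (sq x) * \<eta> x + dL_v L (sq x) * V x + dL_w L (sq x) * W x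
      + dL_z L (sq x) * integral {a..x} (\<lambda>t. dl_y l (cu t) * \<eta> t + dl_v l (cu t) * V t + dl_w l (cu t) * W t)))
    (at 0)"
proof -
  let ?v = "caputo_left a \<alpha> y" and ?w = "rl_left_integral a \<beta> y"
  define cu' where "cu' e t = (t, y t + e * \<eta> t, ?v t + e * V t, ?w t + e * W t)" for e t
  define z where "z e x = integral {a..x} (\<lambda>t. l (cu' e t))" for e x
  define sq' where "sq' e t = (t, y t + e * \<eta> t, ?v t + e * V t, ?w t + e * W t, z e t)" for e t
  have c: "continuous_on {a..b} y" "continuous_on {a..b} ?v" "continuous_on {a..b} ?w"
    using y by (auto simp: frac_class_def intro: abs_continuous_on_imp_continuous_on)
  have \<eta>: "continuous_on {a..b} \<eta>" unfolding \<eta>_def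
    by (intro indefinite_integral_continuous_1 integrable_continuous_real h)
  have V: "continuous_on {a..b} V" unfolding V_def using \<alpha> by (intro continuous_on_rl_left_integral h) simp
  have W: "continuous_on {a..b} W" unfolding W_def by (intro continuous_on_rl_left_integral \<eta> \<beta>)
  have \<eta>_app: "integral {a..x} h = \<eta> x" for x by (simp add: \<eta>_def)
  note variation = frac_class_variation(2,3)[OF ab \<alpha> \<beta> y h, unfolded \<eta>_app, folded V_def W_def]
  have cu_e: "curly_args a \<alpha> \<beta> (\<lambda>x. y x + e * \<eta> x) t = cu' e t" if "t \<in> {a..b}" for e t
    using variation[OF that] by (simp add: curly_args_def cu'_def)
  have z_e: "aux_z l a \<alpha> \<beta> (\<lambda>x. y x + e * \<eta> x) x = z e x" if "x \<in> {a..b}" for e x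
    unfolding aux_z_def z_def using that by (intro Henstock_Kurzweil_Integration.integral_cong) (simp add: cu_e)
  have sq_e: "square_args l a \<alpha> \<beta> (\<lambda>x. y x + e * \<eta> x) t = sq' e t" if "t \<in> {a..b}" for e t
    using variation[OF that] z_e[OF that] by (simp add: square_args_def sq'_def)
  have J: "J_functional L l a b \<alpha> \<beta> (\<lambda>x. y x + e * \<eta> x) = integral {a..b} (\<lambda>x. L (sq' e x))" for e
    unfolding J_functional_def by (intro Henstock_Kurzweil_Integration.integral_cong) (simp add: sq_e)
  have cu0: "cu' 0 = cu" by (simp add: cu'_def cu_def curly_args_def fun_eq_iff)
  have sq0: "sq' 0 = sq" by (simp add: sq'_def sq_def square_args_def aux_z_def z_def cu0 cu_def fun_eq_iff)
  from first_variation[OF L l c \<eta> V W, folded cu'_def, folded z_def, folded sq'_def]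
  show ?thesis unfolding J cu0 sq0 .
qed

text \<open>The two functions to be differentiated stay together under one fractional integral: the
  variational identity tests only their sum.\<close>

lemma integrated_Euler_Lagrange:
  fixes y :: "real \<Rightarrow> real"
  assumes ab: "a < b" and \<alpha>: "0 < \<alpha>" "\<alpha> < 1" and \<beta>: "0 < \<beta>"
    and L: "C1_on ({a..b} \<times> UNIV) L" and l: "C1_on ({a..b} \<times> UNIV) l"
    and min: "is_constrained_minimizer L l a b \<alpha> \<beta> ya yb y"
  defines "sq \<equiv> square_args l a \<alpha> \<beta> y" and "cu \<equiv> curly_args a \<alpha> \<beta> y"
  defines "P \<equiv> \<lambda>x. integral {x..b} (\<lambda>t. dL_z L (sq t))"
  shows "continuous_on {a..b} (\<lambda>x. dL_v L (sq x))" "continuous_on {a..b} (\<lambda>x. P x * dl_v l (cu x))"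
    "continuous_on {a..b} (\<lambda>x. dL_w L (sq x))" "continuous_on {a..b} (\<lambda>x. P x * dl_w l (cu x))"
    "\<And>x. x \<in> {a..b} \<Longrightarrow>
      (rl_right_integral b (1 - \<alpha>) (\<lambda>x. dL_v L (sq x) + P x * dl_v l (cu x)) has_real_derivative
        dL_y L (sq x) + P x * dl_y l (cu x)
        + rl_right_integral b \<beta> (\<lambda>x. dL_w L (sq x) + P x * dl_w l (cu x)) x) (at x within {a..b})"
proof -
  have y: "y \<in> frac_class a b \<alpha> \<beta>" "y a = ya" "y b = yb"
    and opt: "\<And>u. u \<in> frac_class a b \<alpha> \<beta> \<Longrightarrow> u a = ya \<Longrightarrow> u b = yb \<Longrightarrow>
        J_functional L l a b \<alpha> \<beta> y \<le> J_functional L l a b \<alpha> \<beta> u"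
    using min by (auto simp: is_constrained_minimizer_def)
  note l' = C1_on_lag4[OF l] and L' = C1_on_lag5[OF L]
  have c: "continuous_on {a..b} y" "continuous_on {a..b} (caputo_left a \<alpha> y)" "continuous_on {a..b} (rl_left_integral a \<beta> y)"
    using y(1) by (auto simp: frac_class_def intro: abs_continuous_on_imp_continuous_on)
  have cuc: "continuous_on {a..b} cu" unfolding cu_def curly_args_def[abs_def]
    by (intro continuous_intros c)
  have comp_cu: "continuous_on {a..b} (\<lambda>x. k (cu x))" if "continuous_on ({a..b} \<times> UNIV) k" for k :: lag4
    by (rule continuous_on_compose2[OF that cuc]) (auto simp: cu_def curly_args_def)
  have zc: "continuous_on {a..b} (aux_z l a \<alpha> \<beta> y)"
    unfolding aux_z_def[abs_def] cu_def[symmetric]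
    by (intro indefinite_integral_continuous_1 integrable_continuous_real comp_cu l')
  have sqc: "continuous_on {a..b} sq" unfolding sq_def square_args_def[abs_def]
    by (intro continuous_intros c zc)
  have comp_sq: "continuous_on {a..b} (\<lambda>x. k (sq x))" if "continuous_on ({a..b} \<times> UNIV) k" for k :: lag5
    by (rule continuous_on_compose2[OF that sqc]) (auto simp: sq_def square_args_def)
  \<comment> \<open>As a right integral of order one, \<open>P\<close> inherits continuity and fits
    fractional integration by parts.\<close>
  have P1: "P = rl_right_integral b 1 (\<lambda>t. dL_z L (sq t))" by (simp add: P_def rl_right_integral_1 fun_eq_iff)
  have Pc: "continuous_on {a..b} P" unfolding P1 by (intro continuous_on_rl_right_integral comp_sq L') simp
  note cs = Pc comp_sq[OF L'(2)] comp_sq[OF L'(3)] comp_sq[OF L'(4)] comp_sq[OF L'(5)]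
     comp_cu[OF l'(2)] comp_cu[OF l'(3)] comp_cu[OF l'(4)]
  define A where "A x = dL_y L (sq x) + P x * dl_y l (cu x)" for x
  define \<phi> where "\<phi> x = dL_v L (sq x) + P x * dl_v l (cu x)" for x
  define B where "B x = dL_w L (sq x) + P x * dl_w l (cu x)" for x
  show "continuous_on {a..b} (\<lambda>x. dL_v L (sq x))" "continuous_on {a..b} (\<lambda>x. P x * dl_v l (cu x))"
    "continuous_on {a..b} (\<lambda>x. dL_w L (sq x))" "continuous_on {a..b} (\<lambda>x. P x * dl_w l (cu x))"
    by (intro continuous_intros cs)+
  have AB: "continuous_on {a..b} A" "continuous_on {a..b} \<phi>" "continuous_on {a..b} B"
    unfolding A_def \<phi>_def B_def by (intro continuous_intros cs)+
  define K where "K = rl_right_integral b (1 - \<alpha>) \<phi>"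
  define IB where "IB = rl_right_integral b \<beta> B"
  have K: "continuous_on {a..b} K" unfolding K_def using \<alpha> by (intro continuous_on_rl_right_integral AB) simp
  have IB: "continuous_on {a..b} IB" unfolding IB_def by (intro continuous_on_rl_right_integral AB \<beta>)
  have "(K has_real_derivative A x + IB x) (at x within {a..b})" if x: "x \<in> {a..b}" for x
  proof (rule du_Bois_Reymond[OF ab _ K _ x])
    show "continuous_on {a..b} (\<lambda>x. A x + IB x)" by (intro continuous_intros AB IB)
    fix h :: "real \<Rightarrow> real" assume h: "continuous_on {a..b} h" and h0: "integral {a..b} h = 0"
    define \<eta> where "\<eta> x = integral {a..x} h" for x
    define V where "V = rl_left_integral a (1 - \<alpha>) h"
    define W where "W = rl_left_integral a \<beta> \<eta>"
    define m where "m t = dl_y l (cu t) * \<eta> t + dl_v l (cu t) * V t + dl_w l (cu t) * W t" for t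
    have \<eta>: "continuous_on {a..b} \<eta>" unfolding \<eta>_def
      by (intro indefinite_integral_continuous_1 integrable_continuous_real h)
    have V: "continuous_on {a..b} V" unfolding V_def using \<alpha> by (intro continuous_on_rl_left_integral h) simp
    have W: "continuous_on {a..b} W" unfolding W_def by (intro continuous_on_rl_left_integral \<eta> \<beta>)
    have m: "continuous_on {a..b} m" unfolding m_def by (intro continuous_intros cs \<eta> V W)
    let ?J = "\<lambda>e. J_functional L l a b \<alpha> \<beta> (\<lambda>x. y x + e * \<eta> x)"
    have "?J 0 \<le> ?J e" for e
      using opt[OF frac_class_variation(1)[OF ab \<alpha> \<beta> y(1) h, of e, folded \<eta>_def]] h0 y(2,3)
      by (simp add: \<eta>_def)
    \<comment> \<open>The inequality holds for all \<open>e\<close>, so 0 is a local minimum and the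
      radius 1 is an arbitrary choice.\<close>
    then have "integral {a..b} (\<lambda>x. dL_y L (sq x) * \<eta> x + dL_v L (sq x) * V x + dL_w L (sq x) * W x
      + dL_z L (sq x) * integral {a..x} m) = 0"
      using DERIV_local_min[OF J_functional_variation[OF ab \<alpha> \<beta> L l y(1) h, folded sq_def cu_def \<eta>_def,
          folded V_def W_def, folded m_def] zero_less_one] by (simp add: m_def[abs_def])
    \<comment> \<open>Integration by parts of order one: the inner integral over \<open>m\<close> is
      traded for the factor \<open>P\<close>.\<close>
    moreover have "integral {a..b} (\<lambda>x. dL_z L (sq x) * integral {a..x} m) = integral {a..b} (\<lambda>x. P x * m x)"
      using fractional_integration_by_parts[OF zero_less_one cs(5) m]
      by (simp add: rl_left_integral_1 P1)
    moreover have "continuous_on {a..b} (\<lambda>x. dL_z L (sq x) * integral {a..x} m)"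
      by (intro continuous_intros cs indefinite_integral_continuous_1 integrable_continuous_real m)
    moreover have "continuous_on {a..b} (\<lambda>x. dL_y L (sq x) * \<eta> x + dL_v L (sq x) * V x + dL_w L (sq x) * W x)"
      by (intro continuous_intros cs \<eta> V W)
    moreover have "continuous_on {a..b} (\<lambda>x. P x * m x)" by (intro continuous_intros cs m)
    ultimately have "integral {a..b} (\<lambda>x. dL_y L (sq x) * \<eta> x + dL_v L (sq x) * V x + dL_w L (sq x) * W x + P x * m x) = 0"
      by (simp add: Henstock_Kurzweil_Integration.integral_add integrable_continuous_real)
    moreover have "dL_y L (sq x) * \<eta> x + dL_v L (sq x) * V x + dL_w L (sq x) * W x + P x * m x
        = A x * \<eta> x + \<phi> x * V x + B x * W x" for x
      by (simp add: A_def \<phi>_def B_def m_def algebra_simps)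
    ultimately have 0: "integral {a..b} (\<lambda>x. A x * \<eta> x + \<phi> x * V x + B x * W x) = 0" by simp
    have ic: "continuous_on {a..b} (\<lambda>x. A x * \<eta> x)" "continuous_on {a..b} (\<lambda>x. \<phi> x * V x)"
      "continuous_on {a..b} (\<lambda>x. B x * W x)" "continuous_on {a..b} (\<lambda>x. K x * h x)" "continuous_on {a..b} (\<lambda>x. IB x * \<eta> x)"
      by (intro continuous_intros AB \<eta> V W K IB h)+
    note ii = ic[THEN integrable_continuous_real]
    \<comment> \<open>Both fractional integrals are moved off the variation, leaving only \<eta> and
      \<open>h\<close> as in the du Bois-Reymond lemma.\<close>
    have "integral {a..b} (\<lambda>x. \<phi> x * V x) = integral {a..b} (\<lambda>x. K x * h x)"
      unfolding V_def K_def using \<alpha> by (intro fractional_integration_by_parts AB h) simp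
    moreover have "integral {a..b} (\<lambda>x. B x * W x) = integral {a..b} (\<lambda>x. IB x * \<eta> x)"
      unfolding W_def IB_def by (intro fractional_integration_by_parts AB \<eta> \<beta>)
    ultimately have "integral {a..b} (\<lambda>x. A x * \<eta> x + IB x * \<eta> x + K x * h x) = 0"
      using 0 by (simp add: Henstock_Kurzweil_Integration.integral_add integrable_add ii)
    then show "integral {a..b} (\<lambda>x. (A x + IB x) * integral {a..x} h + K x * h x) = 0"
      by (simp add: \<eta>_def distrib_right)
  qed
  then show "\<And>x. x \<in> {a..b} \<Longrightarrow>
      (rl_right_integral b (1 - \<alpha>) (\<lambda>x. dL_v L (sq x) + P x * dl_v l (cu x)) has_real_derivative
        dL_y L (sq x) + P x * dl_y l (cu x)
        + rl_right_integral b \<beta> (\<lambda>x. dL_w L (sq x) + P x * dl_w l (cu x)) x) (at x within {a..b})"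
    unfolding K_def IB_def A_def \<phi>_def[abs_def] B_def[abs_def] .
qed

text \<open>The argument produces a derivative for the sum \<open>f + g\<close> only. The equation
  with two separate fractional derivatives is therefore asserted wherever one of them exists, which
  forces the other to exist; the merged equation holds at every point.\<close>

theorem theorem1:
  fixes a b \<alpha> \<beta> ya yb :: real
    and L :: "real \<times> real \<times> real \<times> real \<times> real \<Rightarrow> real"
    and l :: "real \<times> real \<times> real \<times> real \<Rightarrow> real"
    and y :: "real \<Rightarrow> real"
  assumes "a < b" and "0 < \<alpha>" and "\<alpha> < 1" and "0 < \<beta>"
    and "C1_on ({a..b} \<times> UNIV) L"
    and "C1_on ({a..b} \<times> UNIV) l"
    and "is_constrained_minimizer L l a b \<alpha> \<beta> ya yb y"
  shows "let sq = square_args l a \<alpha> \<beta> y;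
             cu = curly_args a \<alpha> \<beta> y;
             P = (\<lambda>x. integral {x..b} (\<lambda>t. dL_z L (sq t)));
             f = (\<lambda>x. dL_v L (sq x));
             g = (\<lambda>x. P x * dl_v l (cu x))
         in \<forall>x\<in>{a..b}.
              (rl_right_deriv_exists a b \<alpha> f x \<or> rl_right_deriv_exists a b \<alpha> g x \<longrightarrow>
                 rl_right_deriv_exists a b \<alpha> f x \<and> rl_right_deriv_exists a b \<alpha> g x \<and>
                 dL_y L (sq x)
                 + rl_right_deriv a b \<alpha> f x
                 + rl_right_integral b \<beta> (\<lambda>t. dL_w L (sq t)) x
                 + P x * dl_y l (cu x)
                 + rl_right_deriv a b \<alpha> g x
                 + rl_right_integral b \<beta> (\<lambda>t. P t * dl_w l (cu t)) x = 0) \<and>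
              (rl_right_deriv_exists a b \<alpha> (\<lambda>t. f t + g t) x \<and>
                 dL_y L (sq x)
                 + rl_right_deriv a b \<alpha> (\<lambda>t. f t + g t) x
                 + rl_right_integral b \<beta> (\<lambda>t. dL_w L (sq t)) x
                 + P x * dl_y l (cu x)
                 + rl_right_integral b \<beta> (\<lambda>t. P t * dl_w l (cu t)) x = 0)"
proof -
  define sq where "sq = square_args l a \<alpha> \<beta> y"
  define cu where "cu = curly_args a \<alpha> \<beta> y"
  define P where "P x = integral {x..b} (\<lambda>t. dL_z L (sq t))" for x
  define f where "f x = dL_v L (sq x)" for x
  define g where "g x = P x * dl_v l (cu x)" for x
  \<comment> \<open>The terms without a fractional derivative; \<open>r\<close> is the derivative of
    the integral of order \<open>1 - \<alpha>\<close> of \<open>f + g\<close>, so the right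
    derivative of the sum is \<open>-r\<close>.\<close>
  define r where "r x = dL_y L (sq x) + P x * dl_y l (cu x) + rl_right_integral b \<beta> (\<lambda>t. dL_w L (sq t)) x
     + rl_right_integral b \<beta> (\<lambda>t. P t * dl_w l (cu t)) x" for x
  note EL = integrated_Euler_Lagrange[OF assms, folded sq_def cu_def, folded P_def, folded f_def g_def]
  let ?I = "rl_right_integral b (1 - \<alpha>)"
  have fg: "continuous_on {a..b} (\<lambda>t. f t + g t)" by (intro continuous_intros EL)
  have sub: "continuous_on {x..b} k" if "x \<in> {a..b}" "continuous_on {a..b} k" for x and k :: "real \<Rightarrow> real"
    using that by (auto intro: continuous_on_subset)
  have D: "(?I (\<lambda>t. f t + g t) has_real_derivative r x) (at x within {a..b})" if x: "x \<in> {a..b}" for x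
    using EL(5)[OF x] rl_right_integral_add[OF assms(4) sub[OF x EL(3)] sub[OF x EL(4)]]
    by (simp add: r_def f_def g_def add_ac)
  have I_add: "?I (\<lambda>t. f t + g t) s = ?I f s + ?I g s" if s: "s \<in> {a..b}" for s
    using assms(3) by (intro rl_right_integral_add sub[OF s] EL) simp
  have tr: "(k' has_real_derivative d) (at x within {a..b})"
    if "(k has_real_derivative d) (at x within {a..b})" "\<And>s. s \<in> {a..b} \<Longrightarrow> k s = k' s" "x \<in> {a..b}"
    for k k' :: "real \<Rightarrow> real" and d x
    by (rule has_field_derivative_transform_within[OF that(1) zero_less_one]) (use that in auto)
  note ex = rl_right_deriv_exists_iff[OF assms(1,3)] and eq = rl_right_deriv_eqI[OF assms(1,3)]
  have "(rl_right_deriv_exists a b \<alpha> f x \<or> rl_right_deriv_exists a b \<alpha> g x \<longrightarrow>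
                 rl_right_deriv_exists a b \<alpha> f x \<and> rl_right_deriv_exists a b \<alpha> g x \<and>
                 dL_y L (sq x)
                 + rl_right_deriv a b \<alpha> f x
                 + rl_right_integral b \<beta> (\<lambda>t. dL_w L (sq t)) x
                 + P x * dl_y l (cu x)
                 + rl_right_deriv a b \<alpha> g x
                 + rl_right_integral b \<beta> (\<lambda>t. P t * dl_w l (cu t)) x = 0) \<and>
              (rl_right_deriv_exists a b \<alpha> (\<lambda>t. f t + g t) x \<and>
                 dL_y L (sq x)
                 + rl_right_deriv a b \<alpha> (\<lambda>t. f t + g t) x
                 + rl_right_integral b \<beta> (\<lambda>t. dL_w L (sq t)) x
                 + P x * dl_y l (cu x)
                 + rl_right_integral b \<beta> (\<lambda>t. P t * dl_w l (cu t)) x = 0)"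
    if x: "x \<in> {a..b}" for x
  proof (intro conjI impI)
    show "rl_right_deriv_exists a b \<alpha> (\<lambda>t. f t + g t) x" using ex[OF fg x] D[OF x] by blast
    show "dL_y L (sq x) + rl_right_deriv a b \<alpha> (\<lambda>t. f t + g t) x
        + rl_right_integral b \<beta> (\<lambda>t. dL_w L (sq t)) x + P x * dl_y l (cu x)
        + rl_right_integral b \<beta> (\<lambda>t. P t * dl_w l (cu t)) x = 0"
      using eq[OF fg x D[OF x]] by (simp add: r_def)
    assume "rl_right_deriv_exists a b \<alpha> f x \<or> rl_right_deriv_exists a b \<alpha> g x"
    \<comment> \<open>On [a, b] the integral of the sum splits, so subtracting a differentiable part
      leaves a differentiable part and the two derivatives add up to \<open>r x\<close>.\<close>
    then obtain d where d: "(?I f has_real_derivative d) (at x within {a..b})"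
      "(?I g has_real_derivative r x - d) (at x within {a..b})"
    proof
      assume "rl_right_deriv_exists a b \<alpha> f x"
      then obtain d where d: "(?I f has_real_derivative d) (at x within {a..b})"
        using ex[OF EL(1) x] by blast
      have "(?I g has_real_derivative r x - d) (at x within {a..b})"
        by (rule tr[OF DERIV_diff[OF D[OF x] d] _ x]) (simp add: I_add)
      with d show thesis by (rule that)
    next
      assume "rl_right_deriv_exists a b \<alpha> g x"
      then obtain d where d: "(?I g has_real_derivative d) (at x within {a..b})"
        using ex[OF EL(2) x] by blast
      have "(?I f has_real_derivative r x - d) (at x within {a..b})"
        by (rule tr[OF DERIV_diff[OF D[OF x] d] _ x]) (simp add: I_add)
      with d show thesis by (intro that[of "r x - d"]) simp_all
    qed
    then show "rl_right_deriv_exists a b \<alpha> f x" "rl_right_deriv_exists a b \<alpha> g x"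
      using ex[OF EL(1) x] ex[OF EL(2) x] by blast+
    show "dL_y L (sq x) + rl_right_deriv a b \<alpha> f x + rl_right_integral b \<beta> (\<lambda>t. dL_w L (sq t)) x
        + P x * dl_y l (cu x) + rl_right_deriv a b \<alpha> g x
        + rl_right_integral b \<beta> (\<lambda>t. P t * dl_w l (cu t)) x = 0"
      using eq[OF EL(1) x d(1)] eq[OF EL(2) x d(2)] by (simp add: r_def)
  qed
  then show ?thesis
    unfolding Let_def f_def[abs_def] g_def[abs_def] P_def[abs_def] sq_def cu_def by blast
qed

end
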